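(* Consider the affine parametric Darcy operator $\mathcal Av=-\nabla_x\cdot(\kappa_{\rm aff}\nabla_xv)$ and the TT ansatz of the context, and assume that the TT-core parametrizations $\theta^s\mapsto G_s(\cdot;\theta^s)$ are differentiable with values in $C^2(\overline{\mathcal D_s})$ entrywise for $s\le d_x$ and in $C(\overline{\mathcal D_s})$ entrywise otherwise. Let $k_s=r_{s-1}r_s$, $a_s=\overline{\alpha_{s-1}\alpha_s}$ and $\mathsf M_{a_s}=\mathrm e_{\alpha_{s-1}}\mathrm e_{\alpha_s}^\top\in\mathbb R^{r_{s-1}\times r_s}$. Then the local-channel factorization $\mathrm J_s=\Psi_s^{\mathrm{ch}}\mathsf C_s^{\mathrm{ch}}$ of the collocated Jacobian blocks holds with sensitivity factor $$\mathsf C_s^{\mathrm{ch}}=\begin{cases}\text{vertical stack of }\mathsf H_{s,0},\mathsf H_{s,1},\mathsf H_{s,2},&s\le d_x,\\ \mathsf H_{s,0},&s>d_x,\end{cases}\qquad N_s^{\mathrm{ch}}=\begin{cases}3n_sk_s,&s\le d_x,\\ n_sk_s,&s>d_x,\end{cases}\qquad \mathsf C_s^{\mathrm{ch}}\in\mathbb R^{N_s^{\mathrm{ch}}\times P_s},$$ and direction factor $\Psi_s^{\mathrm{ch}}=[\Psi_{s,0}^{\mathrm{ch}}\ \Psi_{s,1}^{\mathrm{ch}}\ \Psi_{s,2}^{\mathrm{ch}}]$ for $s\le d_x$, $\Psi_s^{\mathrm{ch}}=\Psi_{s,0}^{\mathrm{ch}}$ for $s>d_x$, $\Psi_s^{\mathrm{ch}}\in\mathbb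 R^{N_{\mathcal D}\times N_s^{\mathrm{ch}}}$, where the local-channel direction matrices $\Psi_{s,\ell}^{\mathrm{ch}}\in\mathbb R^{N_{\mathcal D}\times n_sk_s}$ are given by $$\Psi_{s,\ell}^{\mathrm{ch}}(i,\overline{j_sa_s})=\delta_{i_sj_s}\sum_{j=0}^{d_\xi}\mathcal Q_{<s}^{(j)}(z_{<s,i_{<s}})\,\mathsf P_{s,\ell,a_s}^{(j)}(z_{s,j_s})\,\mathcal Q_{>s}^{(j)}(z_{>s,i_{>s}}),$$ with the $2r_{s-1}\times2r_s$ matrices, for $\ell\in\Lambda_s$, $$\mathsf P_{s,0,a_s}^{(j)}=\kappa_{j,s}\begin{bmatrix}\mathsf M_{a_s}&0\\0&\mathsf M_{a_s}\end{bmatrix},\quad \mathsf P_{s,1,a_s}^{(j)}=-\kappa_{j,s}'\begin{bmatrix}0&\mathsf M_{a_s}\\0&0\end{bmatrix},\quad \mathsf P_{s,2,a_s}^{(j)}=-\kappa_{j,s}\begin{bmatrix}0&\mathsf M_{a_s}\\0&0\end{bmatrix}.$$ The resulting compressed dimension $N_{\mathrm{eff}}^{\mathrm{ch}}=\sum_sN_s^{\mathrm{ch}}$ is $$N_{\mathrm{eff}}^{\mathrm{ch}}=3\sum_{s=1}^{d_x}n_sr_{s-1}r_s+\sum_{s=d_x+1}^dn_sr_{s-1}r_s.$$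
   Context: $\Omega=(0,1)^{d_x}$, $\Xi=(-1,1)^{d_\xi}$, $d=d_x+d_\xi$, $z=(x,\xi)$, $\mathcal D=\Omega\times\Xi=\prod_m\mathcal D_m$. Coefficient: with $\bar\kappa=1$, $\varepsilon=0.1$, $\lambda_j=j^{-2}$, $$\kappa_{\rm aff}(x,\xi)=\bar\kappa+\varepsilon\sum_{j=1}^{d_\xi}\xi_j\sqrt{\lambda_j}\prod_{m=1}^{d_x}\cos(\pi jx_m)=\sum_{j=0}^{d_\xi}\prod_{m=1}^d\kappa_{j,m}(z_m),$$ where $\kappa_{0,1}=\bar\kappa$, $\kappa_{0,m}=1$ ($m\ge2$), and for $j\ge1$: $\kappa_{j,1}(z_1)=\varepsilon\sqrt{\lambda_j}\cos(\pi jz_1)$, $\kappa_{j,m}(z_m)=\cos(\pi jz_m)$ for $2\le m\le d_x$, $\kappa_{j,d_x+j}(z_{d_x+j})=z_{d_x+j}$, and $\kappa_{j,m}=1$ for all other $m>d_x$. Univariate spaces: $H_s$ are Hilbert spaces with $\partial_{z_s}^\ell:H_s\to L^2(\mathcal D_s)$ bounded for $\ell\le2$ if $s\le d_x$ and $\ell=0$ if $s>d_x$, and $H_1\otimes\cdots\otimes H_d$ continuously and densely embedded in $U=L^2(\Xi;V)$, on which $\mathcal A:U\to L^2(\mathcal D)$ is bounded. The operator is separated as $\mathcal A=\sum_{j=0}^{d_\xi}\sum_{q=1}^{d_x}\mathcal A_1^{(j,q)}\otimes\cdots\otimes\mathcal A_d^{(j,q)}$ with $\mathcal A_s^{(j,q)}h=-\kappa_{j,s}'h'-\kappa_{j,s}h''$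 if $s=q$ and $\mathcal A_s^{(j,q)}h=\kappa_{j,s}h$ if $s\ne q$. Local channels: $\Lambda_s=\{0,1,2\}$ for $s\le d_x$, $\Lambda_s=\{0\}$ for $s>d_x$, $\mathcal D_{s,\ell}=\partial_{z_s}^\ell$, with coefficients for $s\le d_x$: $b_{s,0}^{(j,q)}=(1-\delta_{sq})\kappa_{j,s}$, $b_{s,1}^{(j,q)}=-\delta_{sq}\kappa_{j,s}'$, $b_{s,2}^{(j,q)}=-\delta_{sq}\kappa_{j,s}$, and for $s>d_x$: $b_{s,0}^{(j,q)}=\kappa_{j,s}$. TT ansatz: $u_\theta(z)=G_1(z_1;\theta^1)\cdots G_d(z_d;\theta^d)$, $G_m$ valued in $\mathbb R^{r_{m-1}\times r_m}$ with entries in $H_m$, $r_0=r_d=1$, $\theta^m\in\mathbb R^{P_m}$. Block cores: $A_m^{(j)}=\kappa_{j,m}G_m$; $B_m^{(j)}=-\partial_{z_m}(\kappa_{j,m}G_m')$ for $m\le d_x$ and $B_m^{(j)}=0$ for $m>d_x$; $\mathcal B_m^{(j)}=\begin{bmatrix}A_m^{(j)}&B_m^{(j)}\\0&A_m^{(j)}\end{bmatrix}\in\mathbb R^{2r_{m-1}\times2r_m}$; $\mathcal Q_{<s}^{(j)}=\begin{bmatrix}1&0\end{bmatrix}\prod_{m<s}\mathcal B_m^{(j)}\in\mathbb R^{1\times2r_{s-1}}$, $\mathcal Q_{>s}^{(j)}=\big(\prod_{m>s}\mathcal B_m^{(j)}\big)\begin{bmatrix}0\\1\end{bmatrix}\in\mathbb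 R^{2r_s\times1}$ (ordered products), functions of $z_{<s}=(z_1,\dots,z_{s-1})$ and $z_{>s}=(z_{s+1},\dots,z_d)$. Collocation: $\overline{i_1\ldots i_k}$ is the lexicographic position (leftmost index slowest); grids $\{z_{m,1},\dots,z_{m,n_m}\}\subset\mathcal D_m$; $N_{\mathcal D}=\prod_mn_m$; $z_i=(z_{1,i_1},\dots,z_{d,i_d})$ for $i=\overline{i_1\ldots i_d}$; $\mathrm J_s(i,p)=(\mathcal A\partial_{\theta^s_p}u_\theta)(z_i)$, $\mathrm J_s\in\mathbb R^{N_{\mathcal D}\times P_s}$. Sensitivities: $\mathsf H_{s,\ell}\in\mathbb R^{n_sk_s\times P_s}$, $\mathsf H_{s,\ell}(\overline{i_sa_s},p)=(\partial_{z_s}^\ell\partial_{\theta^s_p}G_s)(z_{s,i_s})(\alpha_{s-1},\alpha_s)$. The local-channel direction matrices are defined in general by $\Psi_{s,\ell}^{\mathrm{ch}}(i,\overline{j_sa_s})=\delta_{i_sj_s}\sum_{(j,q)}b_{s,\ell}^{(j,q)}(z_{s,j_s})\,\mathsf E_s^{(j,q)}(\overline{i_{-s}},a_s)$, where $i_{-s}$ omits $i_s$ and $\mathsf E_s^{(j,q)}(\overline{i_{-s}},a_s)=\big[\prod_{m<s}(\mathcal A_m^{(j,q)}G_m)(z_{m,i_m})\big]\mathsf M_{a_s}\big[\prod_{m>s}(\mathcal A_m^{(j,q)}G_m)(z_{m,i_m})\big]$ (operators applied entrywise, empty products equal $1$). *)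

theory Defs
  imports "HOL-Analysis.Derivative" "Jordan_Normal_Form.Matrix"
begin

(* Conventions.  Modes are numbered 1, ..., dx + dxi as in the mathematics; a point z is a function
   nat => real of which only the coordinates z 1, ..., z (dx + dxi) matter.  Grid indices, rank
   indices, parameter indices and matrix positions start at 0.  The data are
     r m     TT rank r_m,                 P m   number of parameters of the m-th core,
     n m     number of grid points,       x m i i-th grid point in mode m,
     G m t y the m-th core G_m(y; t),     th m  parameter vector of the m-th core. *)

section \<open>Coefficient and operator\<close>

definition dom1 :: "nat \<Rightarrow> nat \<Rightarrow> real set" where
  "dom1 dx m = (if m \<le> dx then {0<..<1} else {-1<..<1})"

definition kbar :: real where "kbar = 1"
definition keps :: real where "keps = 1/10"
definition klam :: "nat \<Rightarrow> real" where "klam j = 1 / (real j)\<^sup>2"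

definition kaff :: "nat \<Rightarrow> nat \<Rightarrow> (nat \<Rightarrow> real) \<Rightarrow> real" where
  "kaff dx dxi z = kbar + keps *
     (\<Sum>j=1..dxi. z (dx + j) * sqrt (klam j) * (\<Prod>m=1..dx. cos (pi * real j * z m)))"

text \<open>The univariate factors of the separated coefficient.\<close>
definition kap :: "nat \<Rightarrow> nat \<Rightarrow> nat \<Rightarrow> real \<Rightarrow> real" where
  "kap dx j m y =
     (if j = 0 then (if m = 1 then kbar else 1)
      else if m = 1 then keps * sqrt (klam j) * cos (pi * real j * y)
      else if m \<le> dx then cos (pi * real j * y)
      else if m = dx + j then y
      else 1)"

definition pdiff :: "nat \<Rightarrow> ((nat \<Rightarrow> real) \<Rightarrow> real) \<Rightarrow> (nat \<Rightarrow> real) \<Rightarrow> real" where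
  "pdiff q v z = deriv (\<lambda>t. v (z(q := t))) (z q)"

definition darcy :: "nat \<Rightarrow> nat \<Rightarrow> ((nat \<Rightarrow> real) \<Rightarrow> real) \<Rightarrow> (nat \<Rightarrow> real) \<Rightarrow> real" where
  "darcy dx dxi v z = - (\<Sum>q=1..dx. pdiff q (\<lambda>w. kaff dx dxi w * pdiff q v w) z)"

text \<open>The univariate operators \<open>\<A>\<^sub>s\<close> for the pair \<open>(j,q)\<close>.\<close>
definition loc_op :: "nat \<Rightarrow> nat \<Rightarrow> nat \<Rightarrow> nat \<Rightarrow> (real \<Rightarrow> real) \<Rightarrow> real \<Rightarrow> real" where
  "loc_op dx j q s h y =
     (if s = q then - deriv (kap dx j s) y * deriv h y - kap dx j s y * (deriv ^^ 2) h y
      else kap dx j s y * h y)"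

definition channels :: "nat \<Rightarrow> nat \<Rightarrow> nat set" where
  "channels dx s = (if s \<le> dx then {0,1,2} else {0})"

definition loc_coeff :: "nat \<Rightarrow> nat \<Rightarrow> nat \<Rightarrow> nat \<Rightarrow> nat \<Rightarrow> real \<Rightarrow> real" where
  "loc_coeff dx s l j q y =
     (if s \<le> dx then
        (if l = 0 then (1 - of_bool (s = q)) * kap dx j s y
         else if l = 1 then - of_bool (s = q) * deriv (kap dx j s) y
         else - of_bool (s = q) * kap dx j s y)
      else kap dx j s y)"

section \<open>Differentiable maps into spaces of continuously differentiable functions\<close>

text \<open>Iterated derivative relative to a set \<open>S\<close> (one-sided at the end points of a closed interval).\<close>
primrec dwithin :: "real set \<Rightarrow> nat \<Rightarrow> (real \<Rightarrow> real) \<Rightarrow> real \<Rightarrow> real" where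
  "dwithin S 0 f = f"
| "dwithin S (Suc l) f = (\<lambda>y. vector_derivative (dwithin S l f) (at y within S))"

definition Ck_on :: "nat \<Rightarrow> real set \<Rightarrow> (real \<Rightarrow> real) \<Rightarrow> bool" where
  "Ck_on k S f \<longleftrightarrow>
     (\<forall>l<k. dwithin S l f differentiable_on S) \<and> (\<forall>l\<le>k. continuous_on S (dwithin S l f))"

definition Ck_norm :: "nat \<Rightarrow> real set \<Rightarrow> (real \<Rightarrow> real) \<Rightarrow> real" where
  "Ck_norm k S f = (\<Sum>l\<le>k. SUP y\<in>S. \<bar>dwithin S l f y\<bar>)"

definition vnorm :: "real vec \<Rightarrow> real" where
  "vnorm v = sqrt (scalar_prod v v)"

text \<open>Frechet differentiability of a map from \<open>\<real>\<^sup>P\<close> to \<open>C\<^sup>k(S)\<close>, \<open>S\<close> compact.  A linear map between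
  these spaces has the form \<open>e \<mapsto> \<Sum>p<P. e\<^sub>p h\<^sub>p\<close> with \<open>h\<^sub>p \<in> C\<^sup>k(S)\<close>, and is automatically bounded.\<close>
definition Ck_differentiable :: "nat \<Rightarrow> real set \<Rightarrow> nat \<Rightarrow> (real vec \<Rightarrow> real \<Rightarrow> real) \<Rightarrow> bool" where
  "Ck_differentiable k S P g \<longleftrightarrow>
     (\<forall>t\<in>carrier_vec P. Ck_on k S (g t)) \<and>
     (\<forall>t\<in>carrier_vec P. \<exists>h. (\<forall>p<P. Ck_on k S (h p)) \<and>
        (\<forall>\<epsilon>>0. \<exists>\<delta>>0. \<forall>e\<in>carrier_vec P. vnorm e < \<delta> \<longrightarrow>
           Ck_norm k S (\<lambda>y. g (t + e) y - g t y - (\<Sum>p<P. e $ p * h p y)) \<le> \<epsilon> * vnorm e))"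

section \<open>Lexicographic positions\<close>

text \<open>\<open>lexpos n ms i\<close> is the position of the multi-index \<open>i\<close> over the modes listed in \<open>ms\<close>
  (first mode slowest); \<open>lexidx n ms\<close> is its inverse.  A position \<open>i a\<close> formed from two indices,
  the second one smaller than \<open>k\<close>, is written \<open>i * k + a\<close>.\<close>
definition lexpos :: "(nat \<Rightarrow> nat) \<Rightarrow> nat list \<Rightarrow> (nat \<Rightarrow> nat) \<Rightarrow> nat" where
  "lexpos n ms i = foldl (\<lambda>acc m. acc * n m + i m) 0 ms"

fun lexidx :: "(nat \<Rightarrow> nat) \<Rightarrow> nat list \<Rightarrow> nat \<Rightarrow> nat \<Rightarrow> nat" where
  "lexidx n [] I = (\<lambda>_. 0)"
| "lexidx n (m # ms) I =
     (lexidx n ms (I mod prod_list (map n ms)))(m := I div prod_list (map n ms))"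

lemma foldl_lex:
  "foldl (\<lambda>acc m. acc * n m + i m) c ms = c * prod_list (map n ms) + lexpos n ms i"
  for c :: nat
proof (induction ms arbitrary: c)
  case Nil
  show ?case by (simp add: lexpos_def)
next
  case (Cons m ms)
  show ?case
    using Cons[of "c * n m + i m"] Cons[of "i m"] by (simp add: lexpos_def algebra_simps)
qed

lemma lexpos_Cons: "lexpos n (m # ms) i = i m * prod_list (map n ms) + lexpos n ms i"
  using foldl_lex[of n i "i m" ms] by (simp add: lexpos_def)

lemma lexpos_less: "(\<And>m. m \<in> set ms \<Longrightarrow> i m < n m) \<Longrightarrow> lexpos n ms i < prod_list (map n ms)"
proof (induction ms)
  case Nil
  show ?case by (simp add: lexpos_def)
next
  case (Cons m ms)
  then have "lexpos n ms i < prod_list (map n ms)" "Suc (i m) \<le> n m"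
    by (auto simp: Suc_le_eq)
  moreover from this(2) have "Suc (i m) * prod_list (map n ms) \<le> n m * prod_list (map n ms)"
    by (rule mult_le_mono1)
  ultimately show ?case by (simp add: lexpos_Cons)
qed

lemma lexidx_lexpos:
  "(\<And>m. m \<in> set ms \<Longrightarrow> i m < n m) \<Longrightarrow> m \<in> set ms \<Longrightarrow> lexidx n ms (lexpos n ms i) m = i m"
proof (induction ms)
  case Nil
  then show ?case by simp
next
  case (Cons a ms)
  have "lexpos n ms i < prod_list (map n ms)"
    using Cons.prems by (intro lexpos_less) auto
  with Cons show ?case by (auto simp: lexpos_Cons)
qed

lemma lexidx_less:
  "I < prod_list (map n ms) \<Longrightarrow> m \<in> set ms \<Longrightarrow> lexidx n ms I m < n m"
proof (induction ms arbitrary: I)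
  case Nil
  then show ?case by simp
next
  case (Cons a ms)
  then have "0 < prod_list (map n ms)" by (cases "prod_list (map n ms)") auto
  with Cons show ?case by (auto simp: less_mult_imp_div_less)
qed

lemma lexpos_cong: "(\<And>m. m \<in> set ms \<Longrightarrow> i m = i' m) \<Longrightarrow> lexpos n ms i = lexpos n ms i'"
  by (induction ms) (auto simp: lexpos_Cons, simp add: lexpos_def)

lemma lexpos_lexidx:
  "distinct ms \<Longrightarrow> I < prod_list (map n ms) \<Longrightarrow> lexpos n ms (lexidx n ms I) = I"
proof (induction ms arbitrary: I)
  case Nil
  then show ?case by (simp add: lexpos_def)
next
  case (Cons a ms)
  let ?W = "prod_list (map n ms)"
  from Cons.prems have W: "0 < ?W" by (cases ?W) auto
  have "lexpos n ms (lexidx n (a # ms) I) = lexpos n ms (lexidx n ms (I mod ?W))"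
    using Cons.prems by (intro lexpos_cong) auto
  also have "\<dots> = I mod ?W" using Cons W by simp
  finally show ?case by (simp add: lexpos_Cons fun_upd_def)
qed

definition modes :: "nat \<Rightarrow> nat list" where
  "modes d = [1..<Suc d]"

definition grid_size :: "nat \<Rightarrow> (nat \<Rightarrow> nat) \<Rightarrow> nat" where
  "grid_size d n = (\<Prod>m=1..d. n m)"

section \<open>Tensor-train ansatz and collocated Jacobian\<close>

text \<open>\<open>oprod k F a b\<close> is the ordered product \<open>F a * \<dots> * F (b - 1)\<close>, where \<open>k\<close> is its number of
  columns; it is the identity of size \<open>k\<close> if there are no factors.\<close>
definition oprod :: "nat \<Rightarrow> (nat \<Rightarrow> real mat) \<Rightarrow> nat \<Rightarrow> nat \<Rightarrow> real mat" where
  "oprod k F a b = foldr (\<lambda>m M. F m * M) [a..<b] (1\<^sub>m k)"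

type_synonym cores = "nat \<Rightarrow> real vec \<Rightarrow> real \<Rightarrow> real mat"

definition tt :: "nat \<Rightarrow> cores \<Rightarrow> (nat \<Rightarrow> real vec) \<Rightarrow> (nat \<Rightarrow> real) \<Rightarrow> real" where
  "tt d G th z = oprod 1 (\<lambda>m. G m (th m) (z m)) 1 (Suc d) $$ (0, 0)"

text \<open>Partial derivative at \<open>t\<close> with respect to the \<open>p\<close>-th of \<open>P\<close> parameters.\<close>
definition par_deriv :: "nat \<Rightarrow> nat \<Rightarrow> (real vec \<Rightarrow> real) \<Rightarrow> real vec \<Rightarrow> real" where
  "par_deriv P p f t = deriv (\<lambda>c. f (t + c \<cdot>\<^sub>v unit_vec P p)) 0"

definition grid_point :: "(nat \<Rightarrow> nat \<Rightarrow> real) \<Rightarrow> (nat \<Rightarrow> nat) \<Rightarrow> nat \<Rightarrow> real" where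
  "grid_point x i = (\<lambda>m. x m (i m))"

definition Jac ::
  "nat \<Rightarrow> nat \<Rightarrow> (nat \<Rightarrow> nat) \<Rightarrow> (nat \<Rightarrow> nat) \<Rightarrow> (nat \<Rightarrow> nat \<Rightarrow> real) \<Rightarrow> cores \<Rightarrow>
   (nat \<Rightarrow> real vec) \<Rightarrow> nat \<Rightarrow> real mat" where
  "Jac dx dxi P n x G th s =
     Matrix.mat (grid_size (dx + dxi) n) (P s) (\<lambda>(I, p).
       darcy dx dxi (\<lambda>z. par_deriv (P s) p (\<lambda>t. tt (dx + dxi) G (th(s := t)) z) (th s))
         (grid_point x (lexidx n (modes (dx + dxi)) I)))"

section \<open>Sensitivity and direction factors\<close>

definition core_size :: "(nat \<Rightarrow> nat) \<Rightarrow> nat \<Rightarrow> nat" where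
  "core_size r s = r (s - 1) * r s"

text \<open>A core position \<open>a < core_size r s\<close> encodes the row \<open>a div r s\<close> and the column \<open>a mod r s\<close>.\<close>
definition unit_core :: "(nat \<Rightarrow> nat) \<Rightarrow> nat \<Rightarrow> nat \<Rightarrow> real mat" where
  "unit_core r s a = Matrix.mat (r (s - 1)) (r s)
     (\<lambda>(\<alpha>, \<beta>). unit_vec (r (s - 1)) (a div r s) $ \<alpha> * unit_vec (r s) (a mod r s) $ \<beta>)"

definition Sens ::
  "(nat \<Rightarrow> nat) \<Rightarrow> (nat \<Rightarrow> nat) \<Rightarrow> (nat \<Rightarrow> nat) \<Rightarrow> (nat \<Rightarrow> nat \<Rightarrow> real) \<Rightarrow> cores \<Rightarrow>
   (nat \<Rightarrow> real vec) \<Rightarrow> nat \<Rightarrow> nat \<Rightarrow> real mat" where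
  "Sens r P n x G th s l =
     Matrix.mat (n s * core_size r s) (P s) (\<lambda>(c, p).
       let i = c div core_size r s; a = c mod core_size r s
       in (deriv ^^ l) (\<lambda>y. par_deriv (P s) p (\<lambda>t. G s t y $$ (a div r s, a mod r s)) (th s)) (x s i))"

text \<open>The operator of mode \<open>m\<close> for the pair \<open>(j,q)\<close>, applied entrywise to the \<open>m\<close>-th core.\<close>
definition op_core ::
  "nat \<Rightarrow> (nat \<Rightarrow> nat) \<Rightarrow> cores \<Rightarrow> (nat \<Rightarrow> real vec) \<Rightarrow> nat \<Rightarrow> nat \<Rightarrow> nat \<Rightarrow> real \<Rightarrow> real mat" where
  "op_core dx r G th j q m y =
     Matrix.mat (r (m - 1)) (r m) (\<lambda>(\<alpha>, \<beta>). loc_op dx j q m (\<lambda>w. G m (th m) w $$ (\<alpha>, \<beta>)) y)"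

text \<open>The environments; they depend on the multi-index \<open>i\<close> only through its entries \<open>i m\<close>, \<open>m \<noteq> s\<close>.\<close>
definition Env ::
  "nat \<Rightarrow> nat \<Rightarrow> (nat \<Rightarrow> nat) \<Rightarrow> (nat \<Rightarrow> nat \<Rightarrow> real) \<Rightarrow> cores \<Rightarrow> (nat \<Rightarrow> real vec) \<Rightarrow>
   nat \<Rightarrow> nat \<Rightarrow> nat \<Rightarrow> (nat \<Rightarrow> nat) \<Rightarrow> nat \<Rightarrow> real" where
  "Env dx dxi r x G th s j q i a =
     (oprod (r (s - 1)) (\<lambda>m. op_core dx r G th j q m (x m (i m))) 1 s
      * unit_core r s a
      * oprod (r (dx + dxi)) (\<lambda>m. op_core dx r G th j q m (x m (i m))) (Suc s) (Suc (dx + dxi)))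
     $$ (0, 0)"

definition Psi_ch ::
  "nat \<Rightarrow> nat \<Rightarrow> (nat \<Rightarrow> nat) \<Rightarrow> (nat \<Rightarrow> nat) \<Rightarrow> (nat \<Rightarrow> nat \<Rightarrow> real) \<Rightarrow> cores \<Rightarrow>
   (nat \<Rightarrow> real vec) \<Rightarrow> nat \<Rightarrow> nat \<Rightarrow> real mat" where
  "Psi_ch dx dxi r n x G th s l =
     Matrix.mat (grid_size (dx + dxi) n) (n s * core_size r s) (\<lambda>(I, c).
       let i = lexidx n (modes (dx + dxi)) I; js = c div core_size r s; a = c mod core_size r s
       in of_bool (i s = js) *
            (\<Sum>j=0..dxi. \<Sum>q=1..dx. loc_coeff dx s l j q (x s js) * Env dx dxi r x G th s j q i a))"

definition append_columns :: "real mat \<Rightarrow> real mat \<Rightarrow> real mat" where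
  "append_columns A B = four_block_mat A B (0\<^sub>m 0 (dim_col A)) (0\<^sub>m 0 (dim_col B))"

definition Psi_full ::
  "nat \<Rightarrow> nat \<Rightarrow> (nat \<Rightarrow> nat) \<Rightarrow> (nat \<Rightarrow> nat) \<Rightarrow> (nat \<Rightarrow> nat \<Rightarrow> real) \<Rightarrow> cores \<Rightarrow>
   (nat \<Rightarrow> real vec) \<Rightarrow> nat \<Rightarrow> real mat" where
  "Psi_full dx dxi r n x G th s =
     (let \<Psi> = Psi_ch dx dxi r n x G th s
      in if s \<le> dx then append_columns (\<Psi> 0) (append_columns (\<Psi> 1) (\<Psi> 2)) else \<Psi> 0)"

definition Sens_full ::
  "nat \<Rightarrow> (nat \<Rightarrow> nat) \<Rightarrow> (nat \<Rightarrow> nat) \<Rightarrow> (nat \<Rightarrow> nat) \<Rightarrow> (nat \<Rightarrow> nat \<Rightarrow> real) \<Rightarrow> cores \<Rightarrow>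
   (nat \<Rightarrow> real vec) \<Rightarrow> nat \<Rightarrow> real mat" where
  "Sens_full dx r P n x G th s =
     (let H = Sens r P n x G th s
      in if s \<le> dx then H 0 @\<^sub>r (H 1 @\<^sub>r H 2) else H 0)"

definition N_ch :: "nat \<Rightarrow> (nat \<Rightarrow> nat) \<Rightarrow> (nat \<Rightarrow> nat) \<Rightarrow> nat \<Rightarrow> nat" where
  "N_ch dx r n s = (if s \<le> dx then 3 * n s * core_size r s else n s * core_size r s)"

definition N_eff :: "nat \<Rightarrow> nat \<Rightarrow> (nat \<Rightarrow> nat) \<Rightarrow> (nat \<Rightarrow> nat) \<Rightarrow> nat" where
  "N_eff dx dxi r n = (\<Sum>s=1..dx + dxi. N_ch dx r n s)"

section \<open>Block cores\<close>

definition A_core ::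
  "nat \<Rightarrow> cores \<Rightarrow> (nat \<Rightarrow> real vec) \<Rightarrow> nat \<Rightarrow> nat \<Rightarrow> real \<Rightarrow> real mat" where
  "A_core dx G th j m y = kap dx j m y \<cdot>\<^sub>m G m (th m) y"

definition B_core ::
  "nat \<Rightarrow> (nat \<Rightarrow> nat) \<Rightarrow> cores \<Rightarrow> (nat \<Rightarrow> real vec) \<Rightarrow> nat \<Rightarrow> nat \<Rightarrow> real \<Rightarrow> real mat" where
  "B_core dx r G th j m y =
     (if m \<le> dx then
        Matrix.mat (r (m - 1)) (r m) (\<lambda>(\<alpha>, \<beta>).
          - deriv (\<lambda>w. kap dx j m w * deriv (\<lambda>w'. G m (th m) w' $$ (\<alpha>, \<beta>)) w) y)
      else 0\<^sub>m (r (m - 1)) (r m))"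

definition block_core ::
  "nat \<Rightarrow> (nat \<Rightarrow> nat) \<Rightarrow> cores \<Rightarrow> (nat \<Rightarrow> real vec) \<Rightarrow> nat \<Rightarrow> nat \<Rightarrow> real \<Rightarrow> real mat" where
  "block_core dx r G th j m y =
     four_block_mat (A_core dx G th j m y) (B_core dx r G th j m y)
                    (0\<^sub>m (r (m - 1)) (r m)) (A_core dx G th j m y)"

definition Q_left ::
  "nat \<Rightarrow> (nat \<Rightarrow> nat) \<Rightarrow> cores \<Rightarrow> (nat \<Rightarrow> real vec) \<Rightarrow> nat \<Rightarrow> nat \<Rightarrow> (nat \<Rightarrow> real) \<Rightarrow> real mat" where
  "Q_left dx r G th j s z =
     mat_of_rows_list 2 [[1, 0]] * oprod (2 * r (s - 1)) (\<lambda>m. block_core dx r G th j m (z m)) 1 s"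

definition Q_right ::
  "nat \<Rightarrow> nat \<Rightarrow> (nat \<Rightarrow> nat) \<Rightarrow> cores \<Rightarrow> (nat \<Rightarrow> real vec) \<Rightarrow> nat \<Rightarrow> nat \<Rightarrow> (nat \<Rightarrow> real) \<Rightarrow> real mat" where
  "Q_right dx dxi r G th j s z =
     oprod (2 * r (dx + dxi)) (\<lambda>m. block_core dx r G th j m (z m)) (Suc s) (Suc (dx + dxi))
     * mat_of_rows_list 1 [[0], [1]]"

definition P_mat :: "nat \<Rightarrow> (nat \<Rightarrow> nat) \<Rightarrow> nat \<Rightarrow> nat \<Rightarrow> nat \<Rightarrow> nat \<Rightarrow> real \<Rightarrow> real mat" where
  "P_mat dx r s l a j y =
     (let M = unit_core r s a; Z = 0\<^sub>m (r (s - 1)) (r s)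
      in if l = 0 then kap dx j s y \<cdot>\<^sub>m four_block_mat M Z Z M
         else if l = 1 then (- deriv (kap dx j s) y) \<cdot>\<^sub>m four_block_mat Z M Z Z
         else (- kap dx j s y) \<cdot>\<^sub>m four_block_mat Z M Z Z)"

end

(* The mixed derivative of u with respect to theta^s_p is again a tensor train, with its s-th core
   replaced by the parameter derivative of G_s.  As kaff is a sum of products, the Darcy operator maps
   a tensor train to a sum over (j,q) of tensor trains with m-th core A_m^(j,q) G_m; expanding the
   s-th factor of each into derivative channels gives the factorization.  In the block form, a product
   of matrices [[A, B], [0, A]] behaves like a product of dual numbers A + eps B, so its eps-part is
   the sum over q of the products with A_q replaced by B_q; this carries out the sum over q.  It
   involves only q <= dx because B_m = 0 for m > dx. *)
theory Submission
  imports Defs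
begin

section \<open>Ordered matrix products\<close>

text \<open>Every derivative here is \<open>deriv\<close>, which is informative only where
  differentiability is known. The delicate function is the parameter derivative of a core entry as a
  function of y: it is formed separately for each y, yet must be differentiated twice in y. Frechet
  differentiability into C^2 settles this: the coefficients of the Frechet derivative lie in C^2,
  and since the C^2 norm dominates point evaluation, they are the parameter derivatives at all y at
  once. Jacobian and sensitivities both differentiate in theta before y, so the two orders are never
  exchanged. Identities between functions of z are available on the open box of the domains, which
  suffices because a partial derivative sees only a short piece of a coordinate line. In the block
  form the slot s is held fixed. Channel 0 collects all q different from s, where the replaced core
  stands on one side of s; channels 1 and 2 retain only q = s, where the environment contains no
  replaced core. Hence \<open>P_mat\<close> is block diagonal in the former case and strictly block
  upper triangular in the latter.\<close>

definition chain :: "(nat \<Rightarrow> nat) \<Rightarrow> (nat \<Rightarrow> real mat) \<Rightarrow> nat \<Rightarrow> nat \<Rightarrow> bool" where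
  "chain r F a b \<longleftrightarrow> (\<forall>m\<in>{a..<b}. F m \<in> carrier_mat (r (m - 1)) (r m))"

lemma chainD: "chain r F a b \<Longrightarrow> a \<le> m \<Longrightarrow> m < b \<Longrightarrow> F m \<in> carrier_mat (r (m - 1)) (r m)"
  by (simp add: chain_def)

lemma chain_mono: "chain r F a b \<Longrightarrow> a \<le> a' \<Longrightarrow> b' \<le> b \<Longrightarrow> chain r F a' b'"
  by (simp add: chain_def)

lemma mult_mat_entry:
  "A \<in> carrier_mat l k \<Longrightarrow> B \<in> carrier_mat k u \<Longrightarrow> i < l \<Longrightarrow> j < u \<Longrightarrow>
   (A * B) $$ (i, j) = (\<Sum>c<k. A $$ (i, c) * B $$ (c, j))"
  by (auto simp: scalar_prod_def atLeast0LessThan intro!: sum.cong)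

lemma mult_mat_entry3:
  assumes "A \<in> carrier_mat 1 k" "B \<in> carrier_mat k l" "C \<in> carrier_mat l 1"
  shows "(A * B * C) $$ (0, 0) = (\<Sum>\<alpha><k. \<Sum>\<beta><l. A $$ (0, \<alpha>) * B $$ (\<alpha>, \<beta>) * C $$ (\<beta>, 0))"
proof -
  have "(A * B * C) $$ (0, 0) = (\<Sum>\<beta><l. (\<Sum>\<alpha><k. A $$ (0, \<alpha>) * B $$ (\<alpha>, \<beta>)) * C $$ (\<beta>, 0))"
    using assms by (subst mult_mat_entry[where k = l and l = 1 and u = 1])
      (auto simp del: index_mult_mat(1) simp: mult_mat_entry[where k = k and l = 1 and u = l] intro!: sum.cong)
  then show ?thesis
    by (simp only: sum_distrib_right) (rule sum.swap)
qed

lemma oprod_refl [simp]: "oprod k F a a = 1\<^sub>m k"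
  by (simp add: oprod_def)

lemma oprod_Cons: "a < b \<Longrightarrow> oprod k F a b = F a * oprod k F (Suc a) b"
  by (simp add: oprod_def upt_conv_Cons)

lemma oprod_cong: "(\<And>m. a \<le> m \<Longrightarrow> m < b \<Longrightarrow> F m = F' m) \<Longrightarrow> oprod k F a b = oprod k F' a b"
  unfolding oprod_def by (rule foldr_cong) auto

lemma oprod_carrier:
  assumes "a \<le> b" "chain r F a b"
  shows "1 \<le> a \<Longrightarrow> k = r (b - 1) \<Longrightarrow> oprod k F a b \<in> carrier_mat (r (a - 1)) (r (b - 1))"
  using assms
proof (induction rule: inc_induct)
  case base
  then show ?case by simp
next
  case (step m)
  have "oprod k F (Suc m) b \<in> carrier_mat (r m) (r (b - 1))"
    using step chain_mono[of r F m b "Suc m" b] by simp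
  moreover have "F m \<in> carrier_mat (r (m - 1)) (r m)"
    using step by (intro chainD[of r F m b]) auto
  ultimately show ?case using step by (simp add: oprod_Cons)
qed

text \<open>Downward induction on the left end, one use of associativity per step. The left product
  ends at mode b - 1, hence \<open>r (b - 1)\<close> as the size of its identity.\<close>

lemma oprod_split:
  assumes "a \<le> b" "b \<le> c" "chain r F a c"
  shows "1 \<le> a \<Longrightarrow> k = r (c - 1) \<Longrightarrow> oprod k F a c = oprod (r (b - 1)) F a b * oprod k F b c"
  using assms
proof (induction rule: inc_induct)
  case base
  have "oprod k F b c \<in> carrier_mat (r (b - 1)) (r (c - 1))"
    using base by (intro oprod_carrier) auto
  then show ?case by simp
next
  case (step m)
  have "oprod k F b c \<in> carrier_mat (r (b - 1)) (r (c - 1))"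
    using step chain_mono[OF step.prems(4), of b c] by (intro oprod_carrier) auto
  moreover have "oprod (r (b - 1)) F (Suc m) b \<in> carrier_mat (r m) (r (b - 1))"
    using step chain_mono[OF step.prems(4), of "Suc m" b] oprod_carrier[of "Suc m" b r F "r (b - 1)"] by auto
  moreover have "F m \<in> carrier_mat (r (m - 1)) (r m)"
    using step by (intro chainD[of r F m c]) auto
  moreover have "oprod k F (Suc m) c = oprod (r (b - 1)) F (Suc m) b * oprod k F b c"
    using step chain_mono[OF step.prems(4), of "Suc m" c] by simp
  ultimately show ?case using step by (simp add: oprod_Cons)
qed

lemma oprod_snoc:
  assumes "1 \<le> a" "a \<le> b" "chain r F a (Suc b)"
  shows "oprod (r b) F a (Suc b) = oprod (r (b - 1)) F a b * F b"
proof -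
  have "F b \<in> carrier_mat (r (b - 1)) (r b)" using assms by (simp add: chain_def)
  then show ?thesis
    using oprod_split[of a b "Suc b" r F "r b"] assms by (simp add: oprod_Cons)
qed

lemma oprod_split_at:
  assumes "1 \<le> a" "a \<le> q" "q < b" "chain r F a b" "k = r (b - 1)"
  shows "oprod k F a b = oprod (r (q - 1)) F a q * F q * oprod k F (Suc q) b"
proof -
  have "oprod k F a b = oprod (r q) F a (Suc q) * oprod k F (Suc q) b"
    using assms oprod_split[of a "Suc q" b r F k] by simp
  then show ?thesis
    using oprod_snoc[of a q r F] assms chain_mono[of r F a b a "Suc q"] by simp
qed

text \<open>With boundary ranks 1 the product is a single number, linear in the core
  \<open>F q\<close> with coefficients from the partial products on both sides. All differentiation
  in one variable or one parameter block passes through this expansion.\<close>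

lemma oprod_entry:
  assumes "r 0 = 1" "r d = 1" "1 \<le> q" "q \<le> d" "chain r F 1 (Suc d)"
  shows "oprod 1 F 1 (Suc d) $$ (0, 0) =
    (\<Sum>\<alpha><r (q - 1). \<Sum>\<beta><r q. oprod (r (q - 1)) F 1 q $$ (0, \<alpha>) * F q $$ (\<alpha>, \<beta>)
       * oprod 1 F (Suc q) (Suc d) $$ (\<beta>, 0))"
proof -
  have "oprod (r (q - 1)) F 1 q \<in> carrier_mat 1 (r (q - 1))"
    using oprod_carrier[of 1 q r F "r (q - 1)"] assms chain_mono[OF assms(5), of 1 q] by simp
  moreover have "oprod 1 F (Suc q) (Suc d) \<in> carrier_mat (r q) 1"
    using oprod_carrier[of "Suc q" "Suc d" r F 1] assms chain_mono[OF assms(5), of "Suc q" "Suc d"] by simp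
  moreover have "F q \<in> carrier_mat (r (q - 1)) (r q)"
    using assms by (simp add: chain_def)
  moreover have "oprod 1 F 1 (Suc d) = oprod (r (q - 1)) F 1 q * F q * oprod 1 F (Suc q) (Suc d)"
    using assms by (intro oprod_split_at) auto
  ultimately show ?thesis
    by (simp only: mult_mat_entry3)
qed

text \<open>Serves to pull the coefficient factors of the undifferentiated modes out of a tensor
  train.\<close>

lemma oprod_smult:
  assumes "a \<le> b" "chain r F a b"
  shows "1 \<le> a \<Longrightarrow> k = r (b - 1) \<Longrightarrow>
    oprod k (\<lambda>m. c m \<cdot>\<^sub>m F m) a b = (\<Prod>m\<in>{a..<b}. c m) \<cdot>\<^sub>m oprod k F a b"
  using assms
proof (induction rule: inc_induct)
  case base
  then show ?case by (auto simp: one_mat_def smult_mat_def)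
next
  case (step m)
  have 1: "oprod k F (Suc m) b \<in> carrier_mat (r m) (r (b - 1))"
    using step chain_mono[OF step.prems(3), of "Suc m" b] oprod_carrier[of "Suc m" b r F k] by simp
  have 2: "F m \<in> carrier_mat (r (m - 1)) (r m)"
    using step by (intro chainD[of r F m b]) auto
  have 3: "oprod k (\<lambda>m. c m \<cdot>\<^sub>m F m) (Suc m) b = (\<Prod>m\<in>{Suc m..<b}. c m) \<cdot>\<^sub>m oprod k F (Suc m) b"
    using step chain_mono[OF step.prems(3), of "Suc m" b] by simp
  have 4: "{m..<b} = insert m {Suc m..<b}" using step by auto
  show ?case
    unfolding oprod_Cons[OF step.hyps(2)] 3 4
    unfolding mult_smult_assoc_mat[OF 2 smult_carrier_mat[OF 1]] mult_smult_distrib[OF 2 1]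
    by (intro eq_matI) (auto simp: mult.assoc)
qed

lemma oprod_zero:
  assumes "1 \<le> a" "a \<le> q" "q < b" "chain r F a b" "k = r (b - 1)" "F q = 0\<^sub>m (r (q - 1)) (r q)"
  shows "oprod k F a b = 0\<^sub>m (r (a - 1)) (r (b - 1))"
proof -
  have "oprod (r (q - 1)) F a q \<in> carrier_mat (r (a - 1)) (r (q - 1))"
    using oprod_carrier[of a q r F "r (q - 1)"] assms chain_mono[OF assms(4), of a q] by simp
  moreover have "oprod k F (Suc q) b \<in> carrier_mat (r q) (r (b - 1))"
    using oprod_carrier[of "Suc q" b r F k] assms chain_mono[OF assms(4), of "Suc q" b] by simp
  moreover have "oprod k F a b = oprod (r (q - 1)) F a q * F q * oprod k F (Suc q) b"
    using assms by (intro oprod_split_at) auto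
  ultimately show ?thesis
    using assms(6) by simp
qed

section \<open>Partial derivatives in spaces of continuously differentiable functions\<close>

text \<open>\<open>vector_derivative\<close> chooses some value satisfying a predicate. The
  predicates of \<open>f\<close> and \<open>g\<close> agree for every candidate, so the choices
  agree even without existence or uniqueness of the derivative.\<close>

lemma vector_derivative_cong_on:
  assumes "y \<in> S" "\<And>w. w \<in> S \<Longrightarrow> f w = g w"
  shows "vector_derivative f (at y within S) = vector_derivative g (at y within S)"
proof -
  have "(f has_vector_derivative D) (at y within S) \<longleftrightarrow> (g has_vector_derivative D) (at y within S)" for D
    using has_vector_derivative_transform[of y S f g D] has_vector_derivative_transform[of y S g f D] assms
    by auto
  then show ?thesis by (simp add: vector_derivative_def)
qed

text \<open>Induction on the order. \<open>Ck_on k\<close> gives differentiability of the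
  derivatives of order below \<open>k\<close>, just enough to reach order \<open>k\<close>; as
  points of \<open>S\<close> are limit points, the derivative within \<open>S\<close> is unique and
  the sum rule determines it.\<close>

lemma dwithin_linear:
  assumes lim: "\<And>y. y \<in> S \<Longrightarrow> at y within S \<noteq> bot"
    and f: "Ck_on k S f" and g: "Ck_on k S g"
  shows "l \<le> k \<Longrightarrow> y \<in> S \<Longrightarrow>
    dwithin S l (\<lambda>y. a * f y + b * g y) y = a * dwithin S l f y + b * dwithin S l g y"
proof (induction l arbitrary: y)
  case 0
  then show ?case by simp
next
  case (Suc l)
  have "dwithin S l h differentiable (at y within S)" if "Ck_on k S h" for h
    using that Suc.prems by (auto simp: Ck_on_def differentiable_on_def)
  then have "(dwithin S l h has_vector_derivative dwithin S (Suc l) h y) (at y within S)"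
    if "Ck_on k S h" for h
    using that by (simp flip: vector_derivative_works)
  from this[OF f] this[OF g]
  have D: "((\<lambda>y. a * dwithin S l f y + b * dwithin S l g y) has_vector_derivative
      a * dwithin S (Suc l) f y + b * dwithin S (Suc l) g y) (at y within S)"
    by (intro has_vector_derivative_add has_vector_derivative_mult_right)
  have "dwithin S (Suc l) (\<lambda>y. a * f y + b * g y) y =
      vector_derivative (\<lambda>y. a * dwithin S l f y + b * dwithin S l g y) (at y within S)"
    unfolding dwithin.simps using Suc by (intro vector_derivative_cong_on) auto
  also have "\<dots> = a * dwithin S (Suc l) f y + b * dwithin S (Suc l) g y"
    using lim[OF Suc.prems(2)] D by (rule vector_derivative_within)
  finally show ?case .
qed

lemma Ck_on_linear:
  assumes lim: "\<And>y. y \<in> S \<Longrightarrow> at y within S \<noteq> bot"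
    and f: "Ck_on k S f" and g: "Ck_on k S g"
  shows "Ck_on k S (\<lambda>y. a * f y + b * g y)"
proof -
  note eq = dwithin_linear[OF lim f g, of _ _ a b]
  have "continuous_on S (dwithin S l (\<lambda>y. a * f y + b * g y))" if "l \<le> k" for l
  proof -
    have "continuous_on S (\<lambda>y. a * dwithin S l f y + b * dwithin S l g y)"
      using f g that by (auto simp: Ck_on_def intro!: continuous_intros)
    then show ?thesis
      using eq that by (auto cong: continuous_on_cong)
  qed
  moreover have "dwithin S l (\<lambda>y. a * f y + b * g y) differentiable_on S" if "l < k" for l
    unfolding differentiable_on_def
  proof
    fix y assume y: "y \<in> S"
    have "(\<lambda>y. a * dwithin S l f y + b * dwithin S l g y) differentiable at y within S"
      using f g that y by (auto simp: Ck_on_def differentiable_on_def intro!: derivative_intros)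
    then show "dwithin S l (\<lambda>y. a * f y + b * g y) differentiable at y within S"
      using eq that y by (elim differentiable_transform_within[where d = 1]) auto
  qed
  ultimately show ?thesis by (simp add: Ck_on_def)
qed

text \<open>Shaped like a Frechet remainder: an increment plus a combination of the coefficients of
  the derivative.\<close>

lemma Ck_on_sum:
  fixes P :: nat
  assumes lim: "\<And>y. y \<in> S \<Longrightarrow> at y within S \<noteq> bot"
    and "Ck_on k S h0" "\<And>p. p < P \<Longrightarrow> Ck_on k S (h p)"
  shows "Ck_on k S (\<lambda>y. h0 y + (\<Sum>p<P. c p * h p y))"
  using assms(3)
proof (induction P)
  case 0
  then show ?case using assms(2) by simp
next
  case (Suc P)
  then show ?case
    using Ck_on_linear[OF lim, of k "\<lambda>y. h0 y + (\<Sum>p<P. c p * h p y)" "h P" 1 "c P"]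
    by (simp add: add.assoc)
qed

text \<open>Point evaluation is bounded by the summand of order 0; the other summands are suprema of
  absolute values and hence nonnegative.\<close>

lemma abs_le_Ck_norm:
  assumes "compact S" "Ck_on k S f" "y \<in> S"
  shows "\<bar>f y\<bar> \<le> Ck_norm k S f"
proof -
  \<comment> \<open>A supremum of reals is informative only for a set bounded above; continuity on
    the compact \<open>S\<close> provides this for every order up to \<open>k\<close>.\<close>
  have bdd: "bdd_above ((\<lambda>y. \<bar>dwithin S l f y\<bar>) ` S)" if "l \<le> k" for l
    using assms that
    by (intro bounded_imp_bdd_above compact_imp_bounded compact_continuous_image)
      (auto simp: Ck_on_def intro!: continuous_intros)
  have le: "\<bar>dwithin S l f y\<bar> \<le> (SUP y\<in>S. \<bar>dwithin S l f y\<bar>)" if "l \<le> k" for l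
    using bdd[OF that] assms by (intro cSUP_upper)
  have "\<bar>f y\<bar> \<le> (SUP y\<in>S. \<bar>dwithin S 0 f y\<bar>)"
    using le[of 0] by simp
  also have "\<dots> \<le> Ck_norm k S f"
    unfolding Ck_norm_def
  proof (rule member_le_sum)
    show "0 \<le> (SUP y\<in>S. \<bar>dwithin S l f y\<bar>)" if "l \<in> {..k} - {0}" for l
      using le[of l] that by (auto intro: order_trans[OF abs_ge_zero])
  qed auto
  finally show ?thesis .
qed

lemma vnorm_smult_unit: "p < P \<Longrightarrow> vnorm (c \<cdot>\<^sub>v unit_vec P p) = \<bar>c\<bar>"
  by (simp add: vnorm_def scalar_prod_smult_distrib[where n=P] smult_scalar_prod_distrib[where n=P])

text \<open>The witness is the coefficient \<open>h p\<close> of the Frechet derivative, one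
  function for all y. An increment \<open>c \<cdot>\<^sub>v unit_vec P p\<close> has norm |c| and
  reduces the linear part to \<open>c * h p y\<close>, so the Frechet estimate evaluated at y
  becomes the definition of the derivative in c.\<close>

lemma Ck_differentiable_partial:
  assumes lim: "\<And>y. y \<in> S \<Longrightarrow> at y within S \<noteq> bot" and S: "compact S"
    and g: "Ck_differentiable k S P g" and t: "t \<in> carrier_vec P" and p: "p < P"
  obtains h where "Ck_on k S h"
    "\<And>y. y \<in> S \<Longrightarrow> ((\<lambda>c. g (t + c \<cdot>\<^sub>v unit_vec P p) y) has_real_derivative h y) (at 0)"
proof -
  obtain h where h: "\<And>p. p < P \<Longrightarrow> Ck_on k S (h p)"
    and *: "\<And>\<epsilon>. \<epsilon> > 0 \<Longrightarrow> \<exists>\<delta>>0. \<forall>e\<in>carrier_vec P. vnorm e < \<delta> \<longrightarrow>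
        Ck_norm k S (\<lambda>y. g (t + e) y - g t y - (\<Sum>p<P. e $ p * h p y)) \<le> \<epsilon> * vnorm e"
    using g t unfolding Ck_differentiable_def by blast
  have "((\<lambda>c. g (t + c \<cdot>\<^sub>v unit_vec P p) y) has_real_derivative h p y) (at 0)" if y: "y \<in> S" for y
    unfolding has_field_derivative_def has_derivative_at_alt
  proof (intro conjI allI impI)
    show "bounded_linear ((*) (h p y))" by (rule bounded_linear_mult_right)
    fix \<epsilon> :: real assume "0 < \<epsilon>"
    from *[OF this] obtain \<delta> where "0 < \<delta>" and \<delta>: "\<And>e. e \<in> carrier_vec P \<Longrightarrow> vnorm e < \<delta> \<Longrightarrow>
        Ck_norm k S (\<lambda>y. g (t + e) y - g t y - (\<Sum>p<P. e $ p * h p y)) \<le> \<epsilon> * vnorm e"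
      by blast
    have "\<bar>g (t + c \<cdot>\<^sub>v unit_vec P p) y - g t y - c * h p y\<bar> \<le> \<epsilon> * \<bar>c\<bar>" if "\<bar>c\<bar> < \<delta>" for c
    proof -
      let ?e = "c \<cdot>\<^sub>v unit_vec P p"
      let ?F = "\<lambda>y. g (t + ?e) y - g t y - (\<Sum>p<P. ?e $ p * h p y)"
      have e: "?e \<in> carrier_vec P" by simp
      \<comment> \<open>The evaluation bound applies to C^k functions, so the remainder is exhibited
        as a linear combination of such functions, with coefficients 1, -1 and minus the entries of
        the increment.\<close>
      have "Ck_on k S (\<lambda>y. 1 * g (t + ?e) y + (- 1) * g t y)"
        using g t e unfolding Ck_differentiable_def by (intro Ck_on_linear lim) auto
      from Ck_on_sum[OF lim this, of P h, where c = "\<lambda>p. - vec_index ?e p"]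
      have "Ck_on k S ?F"
        using h by (simp add: sum_negf)
      then have "\<bar>?F y\<bar> \<le> Ck_norm k S ?F"
        by (intro abs_le_Ck_norm S y)
      also have "\<dots> \<le> \<epsilon> * \<bar>c\<bar>"
        using \<delta>[OF e] that p by (simp add: vnorm_smult_unit)
      also have "(\<Sum>p<P. ?e $ p * h p y) = (\<Sum>p'<P. if p' = p then c * h p' y else 0)"
        using p by (intro sum.cong) (auto simp: unit_vec_def)
      also have "\<dots> = c * h p y" using p by simp
      finally show ?thesis .
    qed
    \<comment> \<open>The difference quotient is based at c = 0; adding the zero multiple returns
      \<open>t\<close> because \<open>t\<close> has \<open>P\<close> entries.\<close>
    moreover have "t + 0 \<cdot>\<^sub>v unit_vec P p = t"
      using t by (intro eq_vecI) auto
    ultimately show "\<exists>d>0. \<forall>c. norm (c - 0) < d \<longrightarrow>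
        norm (g (t + c \<cdot>\<^sub>v unit_vec P p) y - g (t + 0 \<cdot>\<^sub>v unit_vec P p) y - h p y * (c - 0)) \<le> \<epsilon> * norm (c - 0)"
      using \<open>0 < \<delta>\<close> by (intro exI[of _ \<delta>]) (auto simp: mult.commute)
  qed
  then show thesis using h[OF p] that by blast
qed

text \<open>On the open set \<open>T\<close> the derivative within \<open>S\<close> is the ordinary
  one. There \<open>deriv f\<close> equals the first derivative of \<open>h\<close> on a whole
  neighbourhood of \<open>y\<close>, so it can be differentiated again.\<close>

lemma Ck_on_open_differentiable:
  assumes C: "Ck_on 2 S h" and T: "open T" "T \<subseteq> S" and eq: "\<And>w. w \<in> T \<Longrightarrow> f w = h w" and y: "y \<in> T"
  shows "f field_differentiable at y" "deriv f field_differentiable at y"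
proof -
  have at: "at w within S = at w" if "w \<in> T" for w
    using T that by (meson at_within_interior interior_maximal subsetD)
  have D: "(f has_real_derivative dwithin S 1 h w) (at w)"
      "(dwithin S 1 h has_real_derivative dwithin S 2 h w) (at w)" if w: "w \<in> T" for w
  proof -
    have "dwithin S l h differentiable (at w within S)" if "l < 2" for l
      using C T w that by (auto simp: Ck_on_def differentiable_on_def)
    then have *: "(dwithin S l h has_vector_derivative dwithin S (Suc l) h w) (at w)" if "l < 2" for l
      using that at[OF w] by (simp flip: vector_derivative_works)
    have "(h has_real_derivative dwithin S 1 h w) (at w)"
      using *[of 0] by (simp add: has_real_derivative_iff_has_vector_derivative)
    then show "(f has_real_derivative dwithin S 1 h w) (at w)"
      by (rule has_field_derivative_transform_within_open[OF _ T(1) w]) (simp add: eq)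
    show "(dwithin S 1 h has_real_derivative dwithin S 2 h w) (at w)"
      using *[of 1] by (simp add: has_real_derivative_iff_has_vector_derivative numeral_2_eq_2)
  qed
  show "f field_differentiable at y"
    using D(1)[OF y] by (auto simp: field_differentiable_def)
  have "(deriv f has_real_derivative dwithin S 2 h y) (at y)"
    using D(2)[OF y] by (rule has_field_derivative_transform_within_open[OF _ T(1) y])
      (simp add: DERIV_imp_deriv[OF D(1)])
  then show "deriv f field_differentiable at y"
    by (auto simp: field_differentiable_def)
qed

lemma closure_dom1: "closure (dom1 dx m) = (if m \<le> dx then {0..1} else {-1..1})"
  by (simp add: dom1_def)

lemma compact_closure_dom1: "compact (closure (dom1 dx m))"
  by (simp add: closure_dom1)

lemma open_dom1: "open (dom1 dx m)"
  by (simp add: dom1_def)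

lemma at_within_closure_dom1: "y \<in> closure (dom1 dx m) \<Longrightarrow> at y within closure (dom1 dx m) \<noteq> bot"
  by (cases "m \<le> dx") (auto simp: closure_dom1 trivial_limit_within islimpt_Icc)

section \<open>The Darcy operator on tensor trains\<close>

text \<open>For j at least 1, mode 1 carries the scalar \<open>keps * sqrt (klam j)\<close> with its
  cosine, modes 2 to dx carry cosines only, and among the parameter modes only dx + j differs from
  1. \<open>1 \<le> dx\<close> makes mode 1 spatial.\<close>

lemma kaff_sum_prod:
  assumes "1 \<le> dx"
  shows "kaff dx dxi z = (\<Sum>j=0..dxi. \<Prod>m=1..dx + dxi. kap dx j m (z m))"
proof -
  have I: "{1..dx + dxi} = insert 1 ({2..dx} \<union> {dx + 1..dx + dxi})"
    using assms by auto
  have J: "{1..dx} = insert 1 {2..dx}"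
    using assms by auto
  have split: "(\<Prod>m=1..dx + dxi. f m) = f 1 * (\<Prod>m=2..dx. f m) * (\<Prod>m=dx + 1..dx + dxi. f m)"
    for f :: "nat \<Rightarrow> real"
    unfolding I using assms by (subst prod.insert) (auto simp: prod.union_disjoint mult.assoc)
  have zero: "(\<Prod>m=1..dx + dxi. kap dx 0 m (z m)) = kbar"
    unfolding split using assms by (auto simp: kap_def)
  have pos: "(\<Prod>m=1..dx + dxi. kap dx j m (z m)) =
      keps * (z (dx + j) * sqrt (klam j) * (\<Prod>m=1..dx. cos (pi * real j * z m)))"
    if "j \<in> {1..dxi}" for j
  proof -
    have "(\<Prod>m=dx + 1..dx + dxi. kap dx j m (z m)) = (\<Prod>m=dx + 1..dx + dxi. if m = dx + j then z m else 1)"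
      using that by (intro prod.cong) (use assms in \<open>auto simp: kap_def\<close>)
    also have "\<dots> = z (dx + j)"
      using that by simp
    finally have "(\<Prod>m=1..dx + dxi. kap dx j m (z m)) =
        kap dx j 1 (z 1) * (\<Prod>m=2..dx. kap dx j m (z m)) * z (dx + j)"
      unfolding split by simp
    also have "(\<Prod>m=2..dx. kap dx j m (z m)) = (\<Prod>m=2..dx. cos (pi * real j * z m))"
      using that by (intro prod.cong) (auto simp: kap_def)
    finally show ?thesis
      unfolding J using that by (simp add: kap_def)
  qed
  show ?thesis
    using sum.cong[OF refl pos, of "{1..dxi}" "\<lambda>j. j"]
    by (simp add: kaff_def sum.atLeast_Suc_atMost zero[unfolded One_nat_def] sum_distrib_left)
qed

lemma kap_differentiable:
  assumes "m \<le> dx"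
  shows "kap dx j m field_differentiable at y"
proof -
  have cos: "(\<lambda>y. c * cos (pi * real j * y)) field_differentiable at y" for c
    unfolding field_differentiable_def by (rule exI, (rule derivative_intros)+)
  consider "j = 0" | "j \<noteq> 0" "m = 1" | "j \<noteq> 0" "m \<noteq> 1"
    by blast
  then show ?thesis
  proof cases
    case 1
    then show ?thesis by (simp add: kap_def [abs_def])
  next
    case 2
    then show ?thesis using cos[of "keps * sqrt (klam j)"] by (simp add: kap_def [abs_def])
  next
    case 3
    then show ?thesis using cos[of 1] assms by (simp add: kap_def [abs_def])
  qed
qed

section \<open>Tensor trains as functions of a single coordinate\<close>

definition mode_box :: "nat \<Rightarrow> nat \<Rightarrow> (nat \<Rightarrow> real) set" where
  "mode_box dx d = {z. \<forall>m\<in>{1..d}. z m \<in> dom1 dx m}"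

text \<open>Starts from scalar entry functions because \<open>loc_op\<close> and differentiation act
  entrywise; the matrix sizes then hold by construction at every point.\<close>

definition core_fun :: "(nat \<Rightarrow> nat) \<Rightarrow> (nat \<Rightarrow> nat \<Rightarrow> nat \<Rightarrow> real \<Rightarrow> real) \<Rightarrow> nat \<Rightarrow> real \<Rightarrow> real mat" where
  "core_fun r f m y = Matrix.mat (r (m - 1)) (r m) (\<lambda>(\<alpha>, \<beta>). f m \<alpha> \<beta> y)"

lemma chain_core_fun [simp]: "chain r (\<lambda>m. core_fun r f m (z m)) a b"
  by (simp add: chain_def core_fun_def)

lemma core_fun_entry [simp]: "\<alpha> < r (m - 1) \<Longrightarrow> \<beta> < r m \<Longrightarrow> core_fun r f m y $$ (\<alpha>, \<beta>) = f m \<alpha> \<beta> y"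
  by (simp add: core_fun_def)

definition tt_fun :: "(nat \<Rightarrow> nat) \<Rightarrow> nat \<Rightarrow> (nat \<Rightarrow> nat \<Rightarrow> nat \<Rightarrow> real \<Rightarrow> real) \<Rightarrow> (nat \<Rightarrow> real) \<Rightarrow> real" where
  "tt_fun r d f z = oprod 1 (\<lambda>m. core_fun r f m (z m)) 1 (Suc d) $$ (0, 0)"

text \<open>The tensor train with cores from \<open>f\<close> except for \<open>h\<close> in mode q,
  already expanded over the two rank indices so that linearity in \<open>h\<close> is
  visible.\<close>

definition tt_slot ::
  "(nat \<Rightarrow> nat) \<Rightarrow> nat \<Rightarrow> (nat \<Rightarrow> nat \<Rightarrow> nat \<Rightarrow> real \<Rightarrow> real) \<Rightarrow> nat \<Rightarrow> (nat \<Rightarrow> nat \<Rightarrow> real \<Rightarrow> real) \<Rightarrow>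
   (nat \<Rightarrow> real) \<Rightarrow> real" where
  "tt_slot r d f q h z =
    (\<Sum>\<alpha><r (q - 1). \<Sum>\<beta><r q. oprod (r (q - 1)) (\<lambda>m. core_fun r f m (z m)) 1 q $$ (0, \<alpha>) * h \<alpha> \<beta> (z q)
       * oprod 1 (\<lambda>m. core_fun r f m (z m)) (Suc q) (Suc d) $$ (\<beta>, 0))"

lemma tt_fun_slot:
  assumes "r 0 = 1" "r d = 1" "1 \<le> q" "q \<le> d"
  shows "tt_fun r d f z = tt_slot r d f q (f q) z"
  unfolding tt_fun_def tt_slot_def
  using assms by (subst oprod_entry[where r = r and q = q]) (auto intro!: sum.cong)

lemma tt_slot_upd:
  "tt_slot r d f q h (z(q := t)) =
    (\<Sum>\<alpha><r (q - 1). \<Sum>\<beta><r q. oprod (r (q - 1)) (\<lambda>m. core_fun r f m (z m)) 1 q $$ (0, \<alpha>) * h \<alpha> \<beta> t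
       * oprod 1 (\<lambda>m. core_fun r f m (z m)) (Suc q) (Suc d) $$ (\<beta>, 0))"
proof -
  have "oprod (r (q - 1)) (\<lambda>m. core_fun r f m ((z(q := t)) m)) 1 q =
      oprod (r (q - 1)) (\<lambda>m. core_fun r f m (z m)) 1 q"
    by (rule oprod_cong) simp
  moreover have "oprod 1 (\<lambda>m. core_fun r f m ((z(q := t)) m)) (Suc q) (Suc d) =
      oprod 1 (\<lambda>m. core_fun r f m (z m)) (Suc q) (Suc d)"
    by (rule oprod_cong) simp
  ultimately show ?thesis
    unfolding tt_slot_def by simp
qed

text \<open>Moving along coordinate q changes only the slot; the partial products on both sides are
  constant by \<open>tt_slot_upd\<close>.\<close>

lemma tt_slot_DERIV:
  assumes "\<And>\<alpha> \<beta>. \<alpha> < r (q - 1) \<Longrightarrow> \<beta> < r q \<Longrightarrow> (h \<alpha> \<beta> has_real_derivative h' \<alpha> \<beta> (z q)) (at (z q))"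
  shows "((\<lambda>t. tt_slot r d f q h (z(q := t))) has_real_derivative tt_slot r d f q h' z) (at (z q))"
  unfolding tt_slot_upd unfolding tt_slot_def
  using assms by (intro DERIV_sum DERIV_cmult_right DERIV_cmult) auto

text \<open>The factor may depend on the slot variable. This is how the coefficient factor of mode q
  enters the slot before the outer derivative is taken.\<close>

lemma tt_slot_smult: "tt_slot r d f q (\<lambda>\<alpha> \<beta> y. c y * h \<alpha> \<beta> y) z = c (z q) * tt_slot r d f q h z"
  unfolding tt_slot_def sum_distrib_left by (intro sum.cong) (auto simp: algebra_simps)

lemma mode_box_upd: "z \<in> mode_box dx d \<Longrightarrow> t \<in> dom1 dx q \<Longrightarrow> z(q := t) \<in> mode_box dx d"
  by (simp add: mode_box_def)

text \<open>The coordinate line through \<open>z\<close> stays in the box while t runs through the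
  open domain of mode q, so agreement on the box is agreement near the point of
  differentiation.\<close>

lemma pdiff_eqI:
  assumes "z \<in> mode_box dx d" "q \<in> {1..d}"
    and "\<And>w. w \<in> mode_box dx d \<Longrightarrow> v w = v' w"
    and "((\<lambda>t. v' (z(q := t))) has_real_derivative D) (at (z q))"
  shows "pdiff q v z = D"
  unfolding pdiff_def
proof (rule DERIV_imp_deriv, rule has_field_derivative_transform_within_open[OF assms(4) open_dom1])
  show "z q \<in> dom1 dx q" using assms by (simp add: mode_box_def)
  show "v' (z(q := t)) = v (z(q := t))" if "t \<in> dom1 dx q" for t
    using assms mode_box_upd[OF assms(1) that] by simp
qed

text \<open>In modes other than q the univariate operator is multiplication by \<open>kap\<close>;
  these factors leave the partial products as scalars.\<close>

lemma tt_fun_loc_op: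
  assumes "r 0 = 1" "r d = 1" "q \<in> {1..d}"
  shows "tt_fun r d (\<lambda>m \<alpha> \<beta>. loc_op dx j q m (f m \<alpha> \<beta>)) z =
    (\<Prod>m\<in>{1..d} - {q}. kap dx j m (z m)) * tt_slot r d f q (\<lambda>\<alpha> \<beta>. loc_op dx j q q (f q \<alpha> \<beta>)) z"
proof -
  let ?f = "\<lambda>m \<alpha> \<beta>. loc_op dx j q m (f m \<alpha> \<beta>)"
  have smult: "core_fun r ?f m (z m) = kap dx j m (z m) \<cdot>\<^sub>m core_fun r f m (z m)" if "m \<noteq> q" for m
    using that by (intro eq_matI) (auto simp: core_fun_def loc_op_def)
  have qd: "1 \<le> q" "q \<le> d" using assms by auto
  have left: "oprod (r (q - 1)) (\<lambda>m. core_fun r ?f m (z m)) 1 q =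
      (\<Prod>m\<in>{1..<q}. kap dx j m (z m)) \<cdot>\<^sub>m oprod (r (q - 1)) (\<lambda>m. core_fun r f m (z m)) 1 q"
    using assms by (subst oprod_smult[where r = r, symmetric]) (auto simp: smult intro!: oprod_cong)
  have right: "oprod 1 (\<lambda>m. core_fun r ?f m (z m)) (Suc q) (Suc d) =
      (\<Prod>m\<in>{Suc q..<Suc d}. kap dx j m (z m)) \<cdot>\<^sub>m oprod 1 (\<lambda>m. core_fun r f m (z m)) (Suc q) (Suc d)"
    using assms by (subst oprod_smult[where r = r, symmetric]) (auto simp: smult intro!: oprod_cong)
  have carrier: "oprod (r (q - 1)) (\<lambda>m. core_fun r f m (z m)) 1 q \<in> carrier_mat (r 0) (r (q - 1))"
      "oprod 1 (\<lambda>m. core_fun r f m (z m)) (Suc q) (Suc d) \<in> carrier_mat (r q) 1"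
    using oprod_carrier[of 1 q r "\<lambda>m. core_fun r f m (z m)" "r (q - 1)"]
      oprod_carrier[of "Suc q" "Suc d" r "\<lambda>m. core_fun r f m (z m)" 1] assms by auto
  have set: "{1..d} - {q} = {1..<q} \<union> {Suc q..<Suc d}"
    using assms by auto
  have prod: "(\<Prod>m\<in>{1..d} - {q}. kap dx j m (z m)) =
      (\<Prod>m\<in>{1..<q}. kap dx j m (z m)) * (\<Prod>m\<in>{Suc q..<Suc d}. kap dx j m (z m))"
    unfolding set by (rule prod.union_disjoint) auto
  show ?thesis
    unfolding tt_fun_slot[OF assms(1,2) qd] tt_slot_def left right prod sum_distrib_left
    using carrier assms(1) by (intro sum.cong refl) simp
qed

text \<open>In each summand of the coefficient the factor of mode q is drawn into slot q, while the
  remaining weight does not depend on coordinate q. The outer derivative therefore acts on \<kappa>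
  f' in that slot alone.\<close>

lemma darcy_tt:
  assumes dims: "1 \<le> dx" and d: "d = dx + dxi" and r: "r 0 = 1" "r d = 1"
    and z: "z \<in> mode_box dx d"
    and v: "\<And>w. w \<in> mode_box dx d \<Longrightarrow> v w = tt_fun r d f w"
    and smooth: "\<And>m \<alpha> \<beta> y. m \<in> {1..dx} \<Longrightarrow> \<alpha> < r (m - 1) \<Longrightarrow> \<beta> < r m \<Longrightarrow> y \<in> dom1 dx m \<Longrightarrow>
      f m \<alpha> \<beta> field_differentiable at y \<and> deriv (f m \<alpha> \<beta>) field_differentiable at y"
  shows "darcy dx dxi v z = (\<Sum>j=0..dxi. \<Sum>q=1..dx. tt_fun r d (\<lambda>m \<alpha> \<beta>. loc_op dx j q m (f m \<alpha> \<beta>)) z)"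
proof -
  have "pdiff q (\<lambda>w. kaff dx dxi w * pdiff q v w) z =
      - (\<Sum>j=0..dxi. tt_fun r d (\<lambda>m \<alpha> \<beta>. loc_op dx j q m (f m \<alpha> \<beta>)) z)" if q: "q \<in> {1..dx}" for q
  proof -
    have qd: "q \<in> {1..d}" using q d by auto
    let ?w = "\<lambda>j z. \<Prod>m\<in>{1..d} - {q}. kap dx j m (z m)"
    have inner: "pdiff q v w = tt_slot r d f q (\<lambda>\<alpha> \<beta>. deriv (f q \<alpha> \<beta>)) w" if w: "w \<in> mode_box dx d" for w
    proof (rule pdiff_eqI[OF w qd])
      show "v w' = tt_slot r d f q (f q) w'" if "w' \<in> mode_box dx d" for w'
        using v[OF that] tt_fun_slot[OF r] qd by simp
      have "w q \<in> dom1 dx q" using w qd by (simp add: mode_box_def)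
      then show "((\<lambda>t. tt_slot r d f q (f q) (w(q := t))) has_real_derivative
          tt_slot r d f q (\<lambda>\<alpha> \<beta>. deriv (f q \<alpha> \<beta>)) w) (at (w q))"
        using smooth[OF q] by (intro tt_slot_DERIV) (auto simp: DERIV_deriv_iff_field_differentiable)
    qed
    let ?h = "\<lambda>j \<alpha> \<beta> y. kap dx j q y * deriv (f q \<alpha> \<beta>) y"
    \<comment> \<open>The derivative of \<kappa> f' is minus \<open>loc_op\<close>; this sign
      cancels the one in front of the sum in \<open>darcy\<close>.\<close>
    let ?h' = "\<lambda>j \<alpha> \<beta> y. - loc_op dx j q q (f q \<alpha> \<beta>) y"
    have flux: "kaff dx dxi w * pdiff q v w = (\<Sum>j=0..dxi. ?w j w * tt_slot r d f q (?h j) w)"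
      if w: "w \<in> mode_box dx d" for w
    proof -
      have "kaff dx dxi w = (\<Sum>j=0..dxi. ?w j w * kap dx j q (w q))"
        unfolding kaff_sum_prod[OF dims] d[symmetric]
        using qd by (intro sum.cong) (auto simp: prod.remove[where x = q])
      then show ?thesis
        by (simp add: inner[OF w] tt_slot_smult sum_distrib_right mult.assoc)
    qed
    have zq: "z q \<in> dom1 dx q" using z qd by (simp add: mode_box_def)
    have "((\<lambda>t. \<Sum>j=0..dxi. ?w j (z(q := t)) * tt_slot r d f q (?h j) (z(q := t))) has_real_derivative
        (\<Sum>j=0..dxi. ?w j z * tt_slot r d f q (?h' j) z)) (at (z q))"
    proof (rule DERIV_sum)
      fix j
      have "(?h j \<alpha> \<beta> has_real_derivative ?h' j \<alpha> \<beta> (z q)) (at (z q))"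
        if "\<alpha> < r (q - 1)" "\<beta> < r q" for \<alpha> \<beta>
      proof -
        have "(kap dx j q has_real_derivative deriv (kap dx j q) (z q)) (at (z q))"
          using kap_differentiable q by (simp add: DERIV_deriv_iff_field_differentiable)
        moreover have "(deriv (f q \<alpha> \<beta>) has_real_derivative (deriv ^^ 2) (f q \<alpha> \<beta>) (z q)) (at (z q))"
          using smooth[OF q that zq] by (simp add: DERIV_deriv_iff_field_differentiable numeral_2_eq_2)
        ultimately show ?thesis
          by (auto intro!: derivative_eq_intros simp: loc_op_def)
      qed
      then have "((\<lambda>t. tt_slot r d f q (?h j) (z(q := t))) has_real_derivative tt_slot r d f q (?h' j) z) (at (z q))"
        by (rule tt_slot_DERIV)
      \<comment> \<open>The weight omits mode q, hence is constant along the line.\<close>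
      moreover have "?w j (z(q := t)) = ?w j z" for t
        by (intro prod.cong) auto
      ultimately show "((\<lambda>t. ?w j (z(q := t)) * tt_slot r d f q (?h j) (z(q := t))) has_real_derivative
          ?w j z * tt_slot r d f q (?h' j) z) (at (z q))"
        by (simp add: DERIV_cmult)
    qed
    from pdiff_eqI[OF z qd flux this]
    have "pdiff q (\<lambda>w. kaff dx dxi w * pdiff q v w) z = (\<Sum>j=0..dxi. ?w j z * tt_slot r d f q (?h' j) z)" .
    also have "\<dots> = (\<Sum>j=0..dxi. - tt_fun r d (\<lambda>m \<alpha> \<beta>. loc_op dx j q m (f m \<alpha> \<beta>)) z)"
      using tt_slot_smult[of r d f q "\<lambda>_. - 1"]
      by (intro sum.cong) (auto simp: tt_fun_loc_op[OF r qd])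
    finally show ?thesis by (simp add: sum_negf)
  qed
  then show ?thesis
    unfolding darcy_def by (subst sum.swap) (simp add: sum_negf)
qed

section \<open>Products of block cores\<close>

lemma sum_shift_lessThan: "(\<Sum>\<gamma>\<in>{k..<k + l}. f \<gamma>) = (\<Sum>\<gamma><l. f (k + \<gamma>))" for f :: "nat \<Rightarrow> real"
  by (rule sum.reindex_bij_witness[of _ "\<lambda>\<gamma>. k + \<gamma>" "\<lambda>\<gamma>. \<gamma> - k"]) auto

lemma lessThan_double_sum: "(\<Sum>\<gamma><2 * k. f \<gamma>) = (\<Sum>\<gamma><k. f \<gamma>) + (\<Sum>\<gamma><k. f (k + \<gamma>))" for f :: "nat \<Rightarrow> real"
proof -
  have "(\<Sum>\<gamma><k + k. f \<gamma>) = (\<Sum>\<gamma><k. f \<gamma>) + (\<Sum>\<gamma>\<in>{k..<k + k}. f \<gamma>)"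
    by (subst sum.union_disjoint[symmetric]) (auto intro!: arg_cong[where f = "sum f"])
  then show ?thesis by (simp add: mult_2 sum_shift_lessThan)
qed

definition blk :: "(nat \<Rightarrow> nat) \<Rightarrow> (nat \<Rightarrow> real mat) \<Rightarrow> (nat \<Rightarrow> real mat) \<Rightarrow> nat \<Rightarrow> real mat" where
  "blk r A B m = four_block_mat (A m) (B m) (0\<^sub>m (r (m - 1)) (r m)) (A m)"

lemma blk_carrier:
  assumes "A m \<in> carrier_mat (r (m - 1)) (r m)" "B m \<in> carrier_mat (r (m - 1)) (r m)"
  shows "blk r A B m \<in> carrier_mat (2 * r (m - 1)) (2 * r m)"
  using assms by (auto simp: blk_def)

text \<open>Block cores satisfy the same compatibility predicate with all ranks doubled, so the
  lemmas on \<open>oprod\<close> apply to them with \<open>\<lambda>m. 2 * r m\<close>.\<close>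

lemma chain_blk: "chain r A a b \<Longrightarrow> chain r B a b \<Longrightarrow> chain (\<lambda>m. 2 * r m) (blk r A B) a b"
  unfolding chain_def by (intro ballI blk_carrier) auto

lemma blk_entry:
  assumes "A m \<in> carrier_mat (r (m - 1)) (r m)" "B m \<in> carrier_mat (r (m - 1)) (r m)"
    and "\<alpha> < r (m - 1)" "\<beta> < r m"
  shows "blk r A B m $$ (\<alpha>, \<beta>) = A m $$ (\<alpha>, \<beta>)"
    and "blk r A B m $$ (\<alpha>, r m + \<beta>) = B m $$ (\<alpha>, \<beta>)"
    and "blk r A B m $$ (r (m - 1) + \<alpha>, \<beta>) = 0"
    and "blk r A B m $$ (r (m - 1) + \<alpha>, r m + \<beta>) = A m $$ (\<alpha>, \<beta>)"
  using assms by (auto simp: blk_def)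

lemma chain_fun_upd: "chain r A a b \<Longrightarrow> chain r B a b \<Longrightarrow> chain r (A(q := B q)) a b"
  by (simp add: chain_def)

lemma left_carrier:
  assumes "r 0 = 1" "1 \<le> s" "chain r A 1 s" "chain r B 1 s"
  shows "mat_of_rows_list 2 [[1, 0]] * oprod (2 * r (s - 1)) (blk r A B) 1 s \<in> carrier_mat 1 (2 * r (s - 1))"
proof -
  have "oprod (2 * r (s - 1)) (blk r A B) 1 s \<in> carrier_mat (2 * r (1 - 1)) (2 * r (s - 1))"
    using assms by (intro oprod_carrier[where r = "\<lambda>m. 2 * r m"] chain_blk) auto
  then show ?thesis
    using assms by (auto simp: mat_of_rows_list_def)
qed

text \<open>The block cores propagate the pair consisting of the product of the \<open>A m\<close> and its formal
  derivative, the sum over \<open>q\<close> of the products in which \<open>A q\<close> is replaced by \<open>B q\<close>.\<close>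
lemma left_entries:
  fixes A B :: "nat \<Rightarrow> real mat"
  assumes "r 0 = 1" "1 \<le> s"
  defines "L \<equiv> \<lambda>s. mat_of_rows_list 2 [[1, 0]] * oprod (2 * r (s - 1)) (blk r A B) 1 s"
  shows "chain r A 1 s \<Longrightarrow> chain r B 1 s \<Longrightarrow> \<forall>\<beta><r (s - 1).
      L s $$ (0, \<beta>) = oprod (r (s - 1)) A 1 s $$ (0, \<beta>) \<and>
      L s $$ (0, r (s - 1) + \<beta>) = (\<Sum>q=1..<s. oprod (r (s - 1)) (A(q := B q)) 1 s $$ (0, \<beta>))"
  using assms(2)
proof (induction s rule: dec_induct)
  case base
  \<comment> \<open>The seed row is the dual number 1: the empty product has value 1 and its
    derivative is the empty sum.\<close>
  have "mat_of_rows_list 2 [[1::real, 0]] \<in> carrier_mat 1 2"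
    by (auto simp: mat_of_rows_list_def)
  then have "L 1 = mat_of_rows_list 2 [[1, 0]]"
    using assms(1) by (auto simp: L_def)
  then show ?case
    using assms(1) by (auto simp: mat_of_rows_list_def)
next
  case (step s)
  have ch: "chain r A 1 s" "chain r B 1 s"
    using step.prems chain_mono by (meson le_SucI order_refl)+
  have IH: "L s $$ (0, \<beta>) = oprod (r (s - 1)) A 1 s $$ (0, \<beta>)"
      "L s $$ (0, r (s - 1) + \<beta>) = (\<Sum>q=1..<s. oprod (r (s - 1)) (A(q := B q)) 1 s $$ (0, \<beta>))"
    if "\<beta> < r (s - 1)" for \<beta>
    using step.IH[OF ch] that by blast+
  have s: "A s \<in> carrier_mat (r (s - 1)) (r s)" "B s \<in> carrier_mat (r (s - 1)) (r s)"
    using step.prems step.hyps by (auto simp: chain_def)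
  have Lc: "L s \<in> carrier_mat 1 (2 * r (s - 1))"
    unfolding L_def using assms(1) step.hyps ch by (intro left_carrier) auto
  have oc: "oprod (2 * r (s - 1)) (blk r A B) 1 s \<in> carrier_mat 2 (2 * r (s - 1))"
    using oprod_carrier[of 1 s "\<lambda>m. 2 * r m" "blk r A B"] chain_blk[OF ch] assms(1) step.hyps by auto
  have "oprod (2 * r s) (blk r A B) 1 (Suc s) = oprod (2 * r (s - 1)) (blk r A B) 1 s * blk r A B s"
    using oprod_snoc[of 1 s "\<lambda>m. 2 * r m" "blk r A B"] chain_blk[OF step.prems] step.hyps by simp
  then have L: "L (Suc s) = L s * blk r A B s"
    unfolding L_def using blk_carrier[of A s r B, OF s] oc
    by (subst assoc_mult_mat[of _ 1 2 _ "2 * r (s - 1)" _ "2 * r s"]) (auto simp: mat_of_rows_list_def)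
  have AS: "oprod (r s) F 1 (Suc s) $$ (0, \<beta>) =
      (\<Sum>\<gamma><r (s - 1). oprod (r (s - 1)) F 1 s $$ (0, \<gamma>) * F s $$ (\<gamma>, \<beta>))"
    if F: "chain r F 1 (Suc s)" and "\<beta> < r s" for F \<beta>
  proof -
    have "chain r F 1 s" using chain_mono[OF F, of 1 s] by simp
    then have "oprod (r (s - 1)) F 1 s \<in> carrier_mat 1 (r (s - 1))"
      using oprod_carrier[of 1 s r F] step.hyps assms(1) by simp
    moreover have "F s \<in> carrier_mat (r (s - 1)) (r s)"
      using F step.hyps by (simp add: chain_def)
    ultimately show ?thesis
      using oprod_snoc[of 1 s r F] step.hyps that by (simp add: mult_mat_entry[where k = "r (s - 1)" and l = 1 and u = "r s"] del: index_mult_mat(1))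
  qed
  note blkc = blk_carrier[of A s r B, OF s] and bl = blk_entry[of A s r B, OF s]
  show ?case
  proof (intro allI impI conjI)
    fix \<beta> assume "\<beta> < r (Suc s - 1)"
    then have \<beta>: "\<beta> < r s" by simp
    have "L (Suc s) $$ (0, \<beta>) = (\<Sum>\<gamma><2 * r (s - 1). L s $$ (0, \<gamma>) * blk r A B s $$ (\<gamma>, \<beta>))"
      unfolding L using \<beta> by (intro mult_mat_entry[OF Lc blkc]) auto
    \<comment> \<open>The lower left block is zero, so only the first half of \<open>L s\<close>
      contributes.\<close>
    also have "\<dots> = (\<Sum>\<gamma><r (s - 1). oprod (r (s - 1)) A 1 s $$ (0, \<gamma>) * A s $$ (\<gamma>, \<beta>))"
      unfolding lessThan_double_sum using IH \<beta> by (simp add: bl del: One_nat_def)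
    finally show "L (Suc s) $$ (0, \<beta>) = oprod (r (Suc s - 1)) A 1 (Suc s) $$ (0, \<beta>)"
      using AS[OF step.prems(1) \<beta>] by simp
    have "L (Suc s) $$ (0, r s + \<beta>) = (\<Sum>\<gamma><2 * r (s - 1). L s $$ (0, \<gamma>) * blk r A B s $$ (\<gamma>, r s + \<beta>))"
      unfolding L using \<beta> by (intro mult_mat_entry[OF Lc blkc]) auto
    \<comment> \<open>Product rule: old value times \<open>B s\<close> plus old derivative times
      \<open>A s\<close>.\<close>
    also have "\<dots> = (\<Sum>\<gamma><r (s - 1). oprod (r (s - 1)) A 1 s $$ (0, \<gamma>) * B s $$ (\<gamma>, \<beta>)) +
        (\<Sum>\<gamma><r (s - 1). (\<Sum>q=1..<s. oprod (r (s - 1)) (A(q := B q)) 1 s $$ (0, \<gamma>)) * A s $$ (\<gamma>, \<beta>))"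
      unfolding lessThan_double_sum using IH \<beta> by (simp add: bl del: One_nat_def)
    also have "(\<Sum>\<gamma><r (s - 1). (\<Sum>q=1..<s. oprod (r (s - 1)) (A(q := B q)) 1 s $$ (0, \<gamma>)) * A s $$ (\<gamma>, \<beta>)) =
        (\<Sum>q=1..<s. \<Sum>\<gamma><r (s - 1). oprod (r (s - 1)) (A(q := B q)) 1 s $$ (0, \<gamma>) * A s $$ (\<gamma>, \<beta>))"
      unfolding sum_distrib_right by (rule sum.swap)
    \<comment> \<open>An update at s is invisible to the factors before s, so this term is the
      summand q = s of the new derivative.\<close>
    also have "(\<Sum>\<gamma><r (s - 1). oprod (r (s - 1)) A 1 s $$ (0, \<gamma>) * B s $$ (\<gamma>, \<beta>)) =
        oprod (r s) (A(s := B s)) 1 (Suc s) $$ (0, \<beta>)"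
      using AS[OF chain_fun_upd[OF step.prems] \<beta>] oprod_cong[of 1 s A "A(s := B s)"] by simp
    also have "(\<Sum>q=1..<s. \<Sum>\<gamma><r (s - 1). oprod (r (s - 1)) (A(q := B q)) 1 s $$ (0, \<gamma>) * A s $$ (\<gamma>, \<beta>)) =
        (\<Sum>q=1..<s. oprod (r s) (A(q := B q)) 1 (Suc s) $$ (0, \<beta>))"
      using AS[OF chain_fun_upd[OF step.prems] \<beta>] by (intro sum.cong) auto
    also have "oprod (r s) (A(s := B s)) 1 (Suc s) $$ (0, \<beta>) + \<dots> =
        (\<Sum>q=1..<Suc s. oprod (r s) (A(q := B q)) 1 (Suc s) $$ (0, \<beta>))"
      unfolding sum.atLeastLessThan_Suc[OF step.hyps(1)] by (rule add.commute)
    finally show "L (Suc s) $$ (0, r (Suc s - 1) + \<beta>) =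
        (\<Sum>q=1..<Suc s. oprod (r (Suc s - 1)) (A(q := B q)) 1 (Suc s) $$ (0, \<beta>))"
      unfolding diff_Suc_1 .
  qed
qed

lemma right_carrier:
  assumes "r d = 1" "a \<le> Suc d" "1 \<le> a" "chain r A a (Suc d)" "chain r B a (Suc d)"
  shows "oprod (2 * r d) (blk r A B) a (Suc d) * mat_of_rows_list 1 [[0], [1]] \<in> carrier_mat (2 * r (a - 1)) 1"
proof -
  have "oprod (2 * r d) (blk r A B) a (Suc d) \<in> carrier_mat (2 * r (a - 1)) (2 * r (Suc d - 1))"
    using assms by (intro oprod_carrier[where r = "\<lambda>m. 2 * r m"] chain_blk) auto
  then show ?thesis
    using assms by (auto simp: mat_of_rows_list_def)
qed

text \<open>Mirror image of \<open>left_entries\<close>: cores are prepended and the seed is the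
  column with entries 0 and 1, so the plain product occupies the lower half and the formal
  derivative the upper half.\<close>

lemma right_entries:
  fixes A B :: "nat \<Rightarrow> real mat"
  assumes "r d = 1" "a \<le> Suc d"
  defines "R \<equiv> \<lambda>a. oprod (2 * r d) (blk r A B) a (Suc d) * mat_of_rows_list 1 [[0], [1]]"
  shows "1 \<le> a \<Longrightarrow> chain r A a (Suc d) \<Longrightarrow> chain r B a (Suc d) \<Longrightarrow> \<forall>\<alpha><r (a - 1).
      R a $$ (r (a - 1) + \<alpha>, 0) = oprod 1 A a (Suc d) $$ (\<alpha>, 0) \<and>
      R a $$ (\<alpha>, 0) = (\<Sum>q=a..<Suc d. oprod 1 (A(q := B q)) a (Suc d) $$ (\<alpha>, 0))"
  using assms(2)
proof (induction a rule: inc_induct)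
  case base
  have "mat_of_rows_list 1 [[0::real], [1]] \<in> carrier_mat 2 1"
    by (auto simp: mat_of_rows_list_def)
  then have "R (Suc d) = mat_of_rows_list 1 [[0], [1]]"
    using assms(1) by (auto simp: R_def)
  then show ?case
    using assms(1) by (auto simp: mat_of_rows_list_def)
next
  case (step a)
  have ch: "chain r A (Suc a) (Suc d)" "chain r B (Suc a) (Suc d)"
    using step.prems chain_mono by (meson le_SucI order_refl)+
  have IH: "R (Suc a) $$ (r a + \<alpha>, 0) = oprod 1 A (Suc a) (Suc d) $$ (\<alpha>, 0)"
      "R (Suc a) $$ (\<alpha>, 0) = (\<Sum>q=Suc a..<Suc d. oprod 1 (A(q := B q)) (Suc a) (Suc d) $$ (\<alpha>, 0))"
    if "\<alpha> < r a" for \<alpha>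
    using step.IH[OF le_SucI[OF step.prems(1)] ch] that unfolding diff_Suc_1 by blast+
  have s: "A a \<in> carrier_mat (r (a - 1)) (r a)" "B a \<in> carrier_mat (r (a - 1)) (r a)"
    using step.prems step.hyps by (auto simp: chain_def)
  note blkc = blk_carrier[of A a r B, OF s] and bl = blk_entry[of A a r B, OF s]
  have Rc: "R (Suc a) \<in> carrier_mat (2 * r a) 1"
    unfolding R_def using right_carrier[of r d "Suc a" A B] assms(1) step.hyps ch by auto
  have oc: "oprod (2 * r d) (blk r A B) (Suc a) (Suc d) \<in> carrier_mat (2 * r a) 2"
    using oprod_carrier[of "Suc a" "Suc d" "\<lambda>m. 2 * r m" "blk r A B"] chain_blk[OF ch] assms(1) step.hyps by auto
  have R: "R a = blk r A B a * R (Suc a)"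
    unfolding R_def oprod_Cons[OF step.hyps(2)] using blkc oc
    by (intro assoc_mult_mat[of _ "2 * r (a - 1)" "2 * r a" _ 2 _ 1]) (auto simp: mat_of_rows_list_def)
  have AS: "oprod 1 F a (Suc d) $$ (\<alpha>, 0) =
      (\<Sum>\<gamma><r a. F a $$ (\<alpha>, \<gamma>) * oprod 1 F (Suc a) (Suc d) $$ (\<gamma>, 0))"
    if F: "chain r F a (Suc d)" and "\<alpha> < r (a - 1)" for F \<alpha>
  proof -
    have "chain r F (Suc a) (Suc d)" using chain_mono[OF F, of "Suc a" "Suc d"] by simp
    then have "oprod 1 F (Suc a) (Suc d) \<in> carrier_mat (r a) 1"
      using oprod_carrier[of "Suc a" "Suc d" r F 1] step.hyps assms(1) by simp
    moreover have "F a \<in> carrier_mat (r (a - 1)) (r a)"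
      using F step.hyps by (simp add: chain_def)
    ultimately show ?thesis
      unfolding oprod_Cons[OF step.hyps(2)] using that by (intro mult_mat_entry) auto
  qed
  show ?case
  proof (intro allI impI conjI)
    fix \<alpha> assume \<alpha>: "\<alpha> < r (a - 1)"
    have "R a $$ (r (a - 1) + \<alpha>, 0) = (\<Sum>\<gamma><2 * r a. blk r A B a $$ (r (a - 1) + \<alpha>, \<gamma>) * R (Suc a) $$ (\<gamma>, 0))"
      unfolding R using \<alpha> by (intro mult_mat_entry[OF blkc Rc]) auto
    also have "\<dots> = (\<Sum>\<gamma><r a. A a $$ (\<alpha>, \<gamma>) * oprod 1 A (Suc a) (Suc d) $$ (\<gamma>, 0))"
      unfolding lessThan_double_sum using IH \<alpha> by (simp add: bl del: One_nat_def)
    finally show "R a $$ (r (a - 1) + \<alpha>, 0) = oprod 1 A a (Suc d) $$ (\<alpha>, 0)"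
      using AS[OF step.prems(2) \<alpha>] by simp
    have "R a $$ (\<alpha>, 0) = (\<Sum>\<gamma><2 * r a. blk r A B a $$ (\<alpha>, \<gamma>) * R (Suc a) $$ (\<gamma>, 0))"
      unfolding R using \<alpha> by (intro mult_mat_entry[OF blkc Rc]) auto
    also have "\<dots> = (\<Sum>\<gamma><r a. B a $$ (\<alpha>, \<gamma>) * oprod 1 A (Suc a) (Suc d) $$ (\<gamma>, 0)) +
        (\<Sum>\<gamma><r a. A a $$ (\<alpha>, \<gamma>) * (\<Sum>q=Suc a..<Suc d. oprod 1 (A(q := B q)) (Suc a) (Suc d) $$ (\<gamma>, 0)))"
      unfolding lessThan_double_sum using IH \<alpha> by (simp add: bl del: One_nat_def sum.op_ivl_Suc)
    also have "(\<Sum>\<gamma><r a. A a $$ (\<alpha>, \<gamma>) * (\<Sum>q=Suc a..<Suc d. oprod 1 (A(q := B q)) (Suc a) (Suc d) $$ (\<gamma>, 0))) =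
        (\<Sum>q=Suc a..<Suc d. \<Sum>\<gamma><r a. A a $$ (\<alpha>, \<gamma>) * oprod 1 (A(q := B q)) (Suc a) (Suc d) $$ (\<gamma>, 0))"
      unfolding sum_distrib_left by (rule sum.swap)
    also have "(\<Sum>\<gamma><r a. B a $$ (\<alpha>, \<gamma>) * oprod 1 A (Suc a) (Suc d) $$ (\<gamma>, 0)) =
        oprod 1 (A(a := B a)) a (Suc d) $$ (\<alpha>, 0)"
      using AS[OF chain_fun_upd[OF step.prems(2,3)] \<alpha>] oprod_cong[of "Suc a" "Suc d" A "A(a := B a)" 1] by simp
    also have "(\<Sum>q=Suc a..<Suc d. \<Sum>\<gamma><r a. A a $$ (\<alpha>, \<gamma>) * oprod 1 (A(q := B q)) (Suc a) (Suc d) $$ (\<gamma>, 0)) =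
        (\<Sum>q=Suc a..<Suc d. oprod 1 (A(q := B q)) a (Suc d) $$ (\<alpha>, 0))"
      using AS[OF chain_fun_upd[OF step.prems(2,3)] \<alpha>] by (intro sum.cong) auto
    also have "oprod 1 (A(a := B a)) a (Suc d) $$ (\<alpha>, 0) + \<dots> =
        (\<Sum>q=a..<Suc d. oprod 1 (A(q := B q)) a (Suc d) $$ (\<alpha>, 0))"
      unfolding sum.atLeast_Suc_lessThan[OF step.hyps(2)] ..
    finally show "R a $$ (\<alpha>, 0) = (\<Sum>q=a..<Suc d. oprod 1 (A(q := B q)) a (Suc d) $$ (\<alpha>, 0))" .
  qed
qed

section \<open>Combined indices and contraction with unit cores\<close>

text \<open>Used both for the core position, which encodes two rank indices, and for the sensitivity
  row, which encodes a grid index and a core position.\<close>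

lemma sum_divmod: "(\<Sum>a<k * l. f (a div l) (a mod l)) = (\<Sum>\<alpha><k. \<Sum>\<beta><l. f \<alpha> \<beta>)" for f :: "nat \<Rightarrow> nat \<Rightarrow> real"
proof -
  have "(\<Sum>a\<in>{m * l..<m * l + l}. f (a div l) (a mod l)) = (\<Sum>\<beta><l. f m \<beta>)" for m
    unfolding sum_shift_lessThan by (intro sum.cong refl) simp
  then show ?thesis
    using sum.nat_group[of "\<lambda>a. f (a div l) (a mod l)" l k] by simp
qed

lemma sum_lessThan_delta:
  "(\<Sum>c<k. of_bool (c = a) * f c) = (if a < k then f a else 0)"
  "(\<Sum>c<k. f c * of_bool (c = a)) = (if a < k then f a else 0)" for f :: "nat \<Rightarrow> real"
  by (simp_all add: of_bool_def if_distrib if_distribR cong: if_cong)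

text \<open>A position below the core size exists only if \<open>r s\<close> is positive, as the
  bound on the remainder requires.\<close>

lemma core_index:
  assumes "a < core_size r s"
  shows "a div r s < r (s - 1)" "a mod r s < r s"
  using assms by (auto simp: core_size_def less_mult_imp_div_less intro!: mod_less_divisor gr0I)

lemma unit_core_carrier: "unit_core r s a \<in> carrier_mat (r (s - 1)) (r s)"
  by (simp add: unit_core_def)

lemma unit_core_entry:
  assumes "\<alpha> < r (s - 1)" "\<beta> < r s" "a < core_size r s"
  shows "unit_core r s a $$ (\<alpha>, \<beta>) = of_bool (\<alpha> = a div r s) * of_bool (\<beta> = a mod r s)"
  using assms core_index[OF assms(3)] by (simp add: unit_core_def unit_vec_def)

text \<open>A unit core selects one entry on either side, which makes every environment a product of
  two scalars.\<close>

lemma mult_unit_core: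
  assumes "X \<in> carrier_mat 1 (r (s - 1))" "Y \<in> carrier_mat (r s) 1" "a < core_size r s"
  shows "(X * unit_core r s a * Y) $$ (0, 0) = X $$ (0, a div r s) * Y $$ (a mod r s, 0)"
proof -
  have "(X * unit_core r s a * Y) $$ (0, 0) = (\<Sum>\<alpha><r (s - 1). \<Sum>\<beta><r s.
      X $$ (0, \<alpha>) * of_bool (\<alpha> = a div r s) * (of_bool (\<beta> = a mod r s) * Y $$ (\<beta>, 0)))"
    unfolding mult_mat_entry3[OF assms(1) unit_core_carrier assms(2)]
    using assms(3) by (intro sum.cong refl) (simp add: unit_core_entry)
  then show ?thesis
    using core_index[OF assms(3)] by (simp flip: sum_distrib_left add: sum_lessThan_delta flip: sum_distrib_right)
qed

text \<open>In the application \<open>X\<close> is a pair (value, derivative) and \<open>Y\<close> a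
  pair (derivative, value). The diagonal blocks of channel 0 combine a derivative on one side with
  the value on the other, as in the product rule; the upper right block of channels 1 and 2 combines
  the two values.\<close>

lemma mult_P_mat:
  fixes r :: "nat \<Rightarrow> nat"
  assumes X: "X \<in> carrier_mat 1 (2 * r (s - 1))" and Y: "Y \<in> carrier_mat (2 * r s) 1" and a: "a < core_size r s"
  defines "a' \<equiv> a div r s" and "b' \<equiv> a mod r s"
  shows "(X * P_mat dx r s 0 a j y * Y) $$ (0, 0) =
      kap dx j s y * (X $$ (0, a') * Y $$ (b', 0) + X $$ (0, r (s - 1) + a') * Y $$ (r s + b', 0))"
    and "(X * P_mat dx r s 1 a j y * Y) $$ (0, 0) = - deriv (kap dx j s) y * (X $$ (0, a') * Y $$ (r s + b', 0))"
    and "(X * P_mat dx r s 2 a j y * Y) $$ (0, 0) = - kap dx j s y * (X $$ (0, a') * Y $$ (r s + b', 0))"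
proof -
  let ?M = "unit_core r s a" and ?Z = "0\<^sub>m (r (s - 1)) (r s) :: real mat"
  note Mc = unit_core_carrier[of r s a]
  have D: "(\<Sum>\<alpha><r (s - 1). \<Sum>\<beta><r s. f \<alpha> * ?M $$ (\<alpha>, \<beta>) * g \<beta>) = f a' * g b'" for f g :: "nat \<Rightarrow> real"
  proof -
    have "(\<Sum>\<alpha><r (s - 1). \<Sum>\<beta><r s. f \<alpha> * ?M $$ (\<alpha>, \<beta>) * g \<beta>) =
        (\<Sum>\<alpha><r (s - 1). \<Sum>\<beta><r s. f \<alpha> * of_bool (\<alpha> = a') * (of_bool (\<beta> = b') * g \<beta>))"
      unfolding a'_def b'_def using a by (intro sum.cong refl) (simp add: unit_core_entry)
    then show ?thesis
      using core_index[OF a] unfolding a'_def b'_def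
      by (simp flip: sum_distrib_left add: sum_lessThan_delta flip: sum_distrib_right)
  qed
  have smult: "(X * (c \<cdot>\<^sub>m N) * Y) $$ (0, 0) = c * (\<Sum>\<alpha><2 * r (s - 1). \<Sum>\<beta><2 * r s. X $$ (0, \<alpha>) * N $$ (\<alpha>, \<beta>) * Y $$ (\<beta>, 0))"
    if "N \<in> carrier_mat (2 * r (s - 1)) (2 * r s)" for c N
    unfolding mult_mat_entry3[OF X smult_carrier_mat[OF that] Y] sum_distrib_left
    using that by (intro sum.cong refl) simp
  have diag: "four_block_mat ?M ?Z ?Z ?M \<in> carrier_mat (2 * r (s - 1)) (2 * r s)"
    and off: "four_block_mat ?Z ?M ?Z ?Z \<in> carrier_mat (2 * r (s - 1)) (2 * r s)"
    using Mc by auto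
  show "(X * P_mat dx r s 0 a j y * Y) $$ (0, 0) =
      kap dx j s y * (X $$ (0, a') * Y $$ (b', 0) + X $$ (0, r (s - 1) + a') * Y $$ (r s + b', 0))"
    using Mc D[of "\<lambda>\<alpha>. X $$ (0, \<alpha>)" "\<lambda>\<beta>. Y $$ (\<beta>, 0)"]
      D[of "\<lambda>\<alpha>. X $$ (0, r (s - 1) + \<alpha>)" "\<lambda>\<beta>. Y $$ (r s + \<beta>, 0)"]
    unfolding P_mat_def Let_def simp_thms if_True smult[OF diag] lessThan_double_sum
    by (simp add: sum.distrib)
  have "(\<Sum>\<alpha><2 * r (s - 1). \<Sum>\<beta><2 * r s. X $$ (0, \<alpha>) * four_block_mat ?Z ?M ?Z ?Z $$ (\<alpha>, \<beta>) * Y $$ (\<beta>, 0)) =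
      X $$ (0, a') * Y $$ (r s + b', 0)"
    using Mc D[of "\<lambda>\<alpha>. X $$ (0, \<alpha>)" "\<lambda>\<beta>. Y $$ (r s + \<beta>, 0)"]
    by (simp add: lessThan_double_sum sum.distrib)
  then show "(X * P_mat dx r s 1 a j y * Y) $$ (0, 0) = - deriv (kap dx j s) y * (X $$ (0, a') * Y $$ (r s + b', 0))"
    and "(X * P_mat dx r s 2 a j y * Y) $$ (0, 0) = - kap dx j s y * (X $$ (0, a') * Y $$ (r s + b', 0))"
    unfolding P_mat_def Let_def using smult[OF off] by simp_all
qed

lemma P_mat_carrier: "P_mat dx r s l a j y \<in> carrier_mat (2 * r (s - 1)) (2 * r s)"
  using unit_core_carrier[of r s a] by (auto simp: P_mat_def Let_def)

lemma append_columns_carrier: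
  "A \<in> carrier_mat k l \<Longrightarrow> B \<in> carrier_mat k l' \<Longrightarrow> append_columns A B \<in> carrier_mat k (l + l')"
  by (auto simp: append_columns_def)

text \<open>Both concatenations are \<open>four_block_mat\<close> with empty blocks, and only the
  upper left block of the product has entries.\<close>

lemma append_columns_mult:
  assumes A: "A \<in> carrier_mat k l" and B: "B \<in> carrier_mat k l'" and C: "C \<in> carrier_mat l u" and D: "D \<in> carrier_mat l' u"
  shows "append_columns A B * (C @\<^sub>r D) = A * C + B * D"
proof -
  have "append_columns A B * (C @\<^sub>r D) = four_block_mat (A * C + B * D) (A * 0\<^sub>m l 0 + B * 0\<^sub>m l' 0)
      (0\<^sub>m 0 l * C + 0\<^sub>m 0 l' * D) (0\<^sub>m 0 l * 0\<^sub>m l 0 + 0\<^sub>m 0 l' * 0\<^sub>m l' 0)"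
    unfolding append_columns_def append_rows_def
    using A B C D by (subst mult_four_block_mat[where ?nr1.0 = k and ?n1.0 = l and ?n2.0 = l' and ?nr2.0 = 0 and ?nc1.0 = u and ?nc2.0 = 0]) auto
  also have "\<dots> = A * C + B * D"
    using A B C D by (intro eq_matI) auto
  finally show ?thesis .
qed

lemma set_modes [simp]: "set (modes d) = {1..d}"
  by (auto simp: modes_def)

lemma prod_list_modes: "prod_list (map n (modes d)) = grid_size d n"
  unfolding modes_def grid_size_def
  by (subst prod.distinct_set_conv_list[symmetric]) (auto intro: prod.cong)

section \<open>The local-channel factorization\<close>

locale darcy_tt_data =
  fixes dx dxi :: nat
    and r P n :: "nat \<Rightarrow> nat"
    and x :: "nat \<Rightarrow> nat \<Rightarrow> real"
    and G :: cores
    and th :: "nat \<Rightarrow> real vec"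
  assumes dims: "1 \<le> dx" "1 \<le> dxi"
    and ranks: "r 0 = 1" "r (dx + dxi) = 1"
    and grid: "\<And>m i. m \<in> {1..dx + dxi} \<Longrightarrow> i < n m \<Longrightarrow> x m i \<in> dom1 dx m"
    and params: "\<And>m. m \<in> {1..dx + dxi} \<Longrightarrow> th m \<in> carrier_vec (P m)"
    and core_dims: "\<And>m t y. m \<in> {1..dx + dxi} \<Longrightarrow> t \<in> carrier_vec (P m) \<Longrightarrow>
          y \<in> closure (dom1 dx m) \<Longrightarrow> G m t y \<in> carrier_mat (r (m - 1)) (r m)"
    and smooth: "\<And>m \<alpha> \<beta>. m \<in> {1..dx + dxi} \<Longrightarrow> \<alpha> < r (m - 1) \<Longrightarrow> \<beta> < r m \<Longrightarrow>
          Ck_differentiable (if m \<le> dx then 2 else 0) (closure (dom1 dx m)) (P m)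
            (\<lambda>t y. G m t y $$ (\<alpha>, \<beta>))"
begin

abbreviation "d \<equiv> dx + dxi"

section \<open>Parameter derivative of the tensor train\<close>

definition core_par_deriv :: "nat \<Rightarrow> nat \<Rightarrow> nat \<Rightarrow> nat \<Rightarrow> real \<Rightarrow> real" where
  "core_par_deriv s p \<alpha> \<beta> y = par_deriv (P s) p (\<lambda>t. G s t y $$ (\<alpha>, \<beta>)) (th s)"

text \<open>The entries of the cores of \<open>\<partial>u / \<partial>\<theta>\<^sup>s\<^sub>p\<close>.\<close>
definition deriv_cores :: "nat \<Rightarrow> nat \<Rightarrow> nat \<Rightarrow> nat \<Rightarrow> nat \<Rightarrow> real \<Rightarrow> real" where
  "deriv_cores s p m = (if m = s then core_par_deriv s p else (\<lambda>\<alpha> \<beta> y. G m (th m) y $$ (\<alpha>, \<beta>)))"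

text \<open>\<open>core_par_deriv\<close> is a derivative at each y separately; identifying it on
  the closed interval with one C^k function makes its dependence on y regular.\<close>

lemma core_partial:
  assumes "s \<in> {1..d}" "p < P s" "\<alpha> < r (s - 1)" "\<beta> < r s"
  obtains h where "Ck_on (if s \<le> dx then 2 else 0) (closure (dom1 dx s)) h"
    "\<And>y. y \<in> closure (dom1 dx s) \<Longrightarrow> core_par_deriv s p \<alpha> \<beta> y = h y"
    "\<And>y. y \<in> closure (dom1 dx s) \<Longrightarrow>
      ((\<lambda>c. G s (th s + c \<cdot>\<^sub>v unit_vec (P s) p) y $$ (\<alpha>, \<beta>)) has_real_derivative core_par_deriv s p \<alpha> \<beta> y) (at 0)"
proof (rule Ck_differentiable_partial[OF at_within_closure_dom1 compact_closure_dom1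
      smooth[OF assms(1,3,4)] params[OF assms(1)] assms(2)])
  fix h
  assume h: "Ck_on (if s \<le> dx then 2 else 0) (closure (dom1 dx s)) h"
    and D: "\<And>y. y \<in> closure (dom1 dx s) \<Longrightarrow>
      ((\<lambda>c. G s (th s + c \<cdot>\<^sub>v unit_vec (P s) p) y $$ (\<alpha>, \<beta>)) has_real_derivative h y) (at 0)"
  have eq: "core_par_deriv s p \<alpha> \<beta> y = h y" if "y \<in> closure (dom1 dx s)" for y
    unfolding core_par_deriv_def par_deriv_def using D[OF that] by (rule DERIV_imp_deriv)
  show thesis
    using that[OF h eq] D eq by simp
qed

lemma core_smooth:
  assumes "m \<in> {1..dx}" "\<alpha> < r (m - 1)" "\<beta> < r m" "y \<in> dom1 dx m"
  shows "(\<lambda>y. G m (th m) y $$ (\<alpha>, \<beta>)) field_differentiable at y"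
    "deriv (\<lambda>y. G m (th m) y $$ (\<alpha>, \<beta>)) field_differentiable at y"
proof -
  have "Ck_on 2 (closure (dom1 dx m)) (\<lambda>y. G m (th m) y $$ (\<alpha>, \<beta>))"
    using smooth[of m \<alpha> \<beta>] params[of m] assms by (auto simp: Ck_differentiable_def)
  note * = Ck_on_open_differentiable[OF this open_dom1 closure_subset refl assms(4)]
  show "(\<lambda>y. G m (th m) y $$ (\<alpha>, \<beta>)) field_differentiable at y"
    "deriv (\<lambda>y. G m (th m) y $$ (\<alpha>, \<beta>)) field_differentiable at y"
    by (rule *)+
qed

lemma deriv_cores_smooth:
  assumes "s \<in> {1..d}" "p < P s"
    and m: "m \<in> {1..dx}" "\<alpha> < r (m - 1)" "\<beta> < r m" "y \<in> dom1 dx m"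
  shows "deriv_cores s p m \<alpha> \<beta> field_differentiable at y \<and> deriv (deriv_cores s p m \<alpha> \<beta>) field_differentiable at y"
proof (cases "m = s")
  case True
  obtain h where "Ck_on (if s \<le> dx then 2 else 0) (closure (dom1 dx s)) h"
    and eq: "\<And>y. y \<in> closure (dom1 dx s) \<Longrightarrow> core_par_deriv s p \<alpha> \<beta> y = h y"
    using m True by (auto intro: core_partial[OF assms(1,2), of \<alpha> \<beta>])
  then have h: "Ck_on 2 (closure (dom1 dx s)) h"
    using m True by simp
  have "core_par_deriv s p \<alpha> \<beta> w = h w" if "w \<in> dom1 dx s" for w
    using eq that closure_subset by blast
  note * = Ck_on_open_differentiable[OF h open_dom1 closure_subset this]
  show ?thesis
    using *[of y] m(4) True by (simp add: deriv_cores_def)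
next
  case False
  then show ?thesis
    using core_smooth[OF m] by (simp add: deriv_cores_def)
qed

lemma core_carrier:
  assumes "m \<in> {1..d}" "t \<in> carrier_vec (P m)" "y \<in> dom1 dx m"
  shows "G m t y \<in> carrier_mat (r (m - 1)) (r m)"
  using core_dims[OF assms(1,2)] assms(3) closure_subset by blast

text \<open>The parameter enters only slot s, in which the train is linear. Points of the box are
  used because the cores have their prescribed sizes on the domains.\<close>

lemma par_deriv_tt:
  assumes s: "s \<in> {1..d}" and p: "p < P s" and z: "z \<in> mode_box dx d"
  shows "par_deriv (P s) p (\<lambda>t. tt d G (th(s := t)) z) (th s) = tt_fun r d (deriv_cores s p) z"
proof -
  let ?K = "\<lambda>m. core_fun r (deriv_cores s p) m (z m)"
  let ?L = "oprod (r (s - 1)) ?K 1 s" and ?R = "oprod 1 ?K (Suc s) (Suc d)"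
  have zm: "z m \<in> dom1 dx m" if "m \<in> {1..d}" for m
    using z that by (simp add: mode_box_def)
  have K: "G m (th m) (z m) = ?K m" if "m \<in> {1..d}" "m \<noteq> s" for m
    using core_carrier[OF that(1) params[OF that(1)] zm[OF that(1)]] that(2)
    by (intro eq_matI) (auto simp: core_fun_def deriv_cores_def)
  have tt: "tt d G (th(s := t)) z = (\<Sum>\<alpha><r (s - 1). \<Sum>\<beta><r s. ?L $$ (0, \<alpha>) * G s t (z s) $$ (\<alpha>, \<beta>) * ?R $$ (\<beta>, 0))"
    if t: "t \<in> carrier_vec (P s)" for t
  proof -
    let ?F = "\<lambda>m. G m ((th(s := t)) m) (z m)"
    have "chain r ?F 1 (Suc d)"
      using core_carrier params zm t by (auto simp: chain_def)
    moreover have "oprod (r (s - 1)) ?F 1 s = ?L"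
      using s K by (intro oprod_cong) auto
    moreover have "oprod 1 ?F (Suc s) (Suc d) = ?R"
      using s K by (intro oprod_cong) auto
    ultimately show ?thesis
      unfolding tt_def using s ranks by (subst oprod_entry[where r = r and q = s]) auto
  qed
  have "((\<lambda>c. \<Sum>\<alpha><r (s - 1). \<Sum>\<beta><r s. ?L $$ (0, \<alpha>) * G s (th s + c \<cdot>\<^sub>v unit_vec (P s) p) (z s) $$ (\<alpha>, \<beta>) * ?R $$ (\<beta>, 0))
      has_real_derivative
      (\<Sum>\<alpha><r (s - 1). \<Sum>\<beta><r s. ?L $$ (0, \<alpha>) * core_par_deriv s p \<alpha> \<beta> (z s) * ?R $$ (\<beta>, 0))) (at 0)"
  proof (intro DERIV_sum DERIV_cmult_right DERIV_cmult)
    fix \<alpha> \<beta> assume "\<alpha> \<in> {..<r (s - 1)}" "\<beta> \<in> {..<r s}"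
    moreover have "z s \<in> closure (dom1 dx s)"
      using zm[OF s] closure_subset by blast
    ultimately show "((\<lambda>c. G s (th s + c \<cdot>\<^sub>v unit_vec (P s) p) (z s) $$ (\<alpha>, \<beta>)) has_real_derivative
        core_par_deriv s p \<alpha> \<beta> (z s)) (at 0)"
      using core_partial[OF s p, of \<alpha> \<beta>] by (metis lessThan_iff)
  qed
  \<comment> \<open>Perturbed parameters keep their dimension for every c, so the expansion holds
    identically in c.\<close>
  moreover have "tt d G (th(s := th s + c \<cdot>\<^sub>v unit_vec (P s) p)) z =
      (\<Sum>\<alpha><r (s - 1). \<Sum>\<beta><r s. ?L $$ (0, \<alpha>) * G s (th s + c \<cdot>\<^sub>v unit_vec (P s) p) (z s) $$ (\<alpha>, \<beta>) * ?R $$ (\<beta>, 0))" for c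
    using params[OF s] by (intro tt) simp
  ultimately have "par_deriv (P s) p (\<lambda>t. tt d G (th(s := t)) z) (th s) =
      (\<Sum>\<alpha><r (s - 1). \<Sum>\<beta><r s. ?L $$ (0, \<alpha>) * core_par_deriv s p \<alpha> \<beta> (z s) * ?R $$ (\<beta>, 0))"
    unfolding par_deriv_def by (simp only: DERIV_imp_deriv)
  also have "\<dots> = tt_fun r d (deriv_cores s p) z"
    using s ranks by (subst tt_fun_slot[where q = s]) (auto simp: tt_slot_def deriv_cores_def)
  finally show ?thesis .
qed

section \<open>Collocated Jacobian and direction factors\<close>

definition op_left :: "nat \<Rightarrow> nat \<Rightarrow> nat \<Rightarrow> (nat \<Rightarrow> nat) \<Rightarrow> real mat" where
  "op_left s j q i = oprod (r (s - 1)) (\<lambda>m. op_core dx r G th j q m (x m (i m))) 1 s"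

definition op_right :: "nat \<Rightarrow> nat \<Rightarrow> nat \<Rightarrow> (nat \<Rightarrow> nat) \<Rightarrow> real mat" where
  "op_right s j q i = oprod 1 (\<lambda>m. op_core dx r G th j q m (x m (i m))) (Suc s) (Suc d)"

lemma chain_op_core: "chain r (\<lambda>m. op_core dx r G th j q m (x m (i m))) a b"
  by (simp add: chain_def op_core_def)

lemma Env_eq:
  assumes s: "s \<in> {1..d}" and a: "a < core_size r s"
  shows "Env dx dxi r x G th s j q i a = op_left s j q i $$ (0, a div r s) * op_right s j q i $$ (a mod r s, 0)"
proof -
  have "op_left s j q i \<in> carrier_mat 1 (r (s - 1))"
    unfolding op_left_def using oprod_carrier[of 1 s r _ "r (s - 1)", OF _ chain_op_core] s ranks by simp
  moreover have "op_right s j q i \<in> carrier_mat (r s) 1"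
    unfolding op_right_def using oprod_carrier[of "Suc s" "Suc d" r _ 1, OF _ chain_op_core] s ranks by simp
  ultimately show ?thesis
    using mult_unit_core[of "op_left s j q i" r s "op_right s j q i" a] a ranks
    by (simp only: Env_def op_left_def op_right_def)
qed

text \<open>Needed because decoding a row position recovers the multi-index on the modes 1 to d and
  is 0 elsewhere.\<close>

lemma Env_cong:
  assumes "\<And>m. m \<in> {1..d} \<Longrightarrow> i m = i' m" "s \<in> {1..d}"
  shows "Env dx dxi r x G th s j q i a = Env dx dxi r x G th s j q i' a"
proof -
  have "oprod (r (s - 1)) (\<lambda>m. op_core dx r G th j q m (x m (i m))) 1 s =
      oprod (r (s - 1)) (\<lambda>m. op_core dx r G th j q m (x m (i' m))) 1 s"
    using assms by (intro oprod_cong) auto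
  moreover have "oprod (r d) (\<lambda>m. op_core dx r G th j q m (x m (i m))) (Suc s) (Suc d) =
      oprod (r d) (\<lambda>m. op_core dx r G th j q m (x m (i' m))) (Suc s) (Suc d)"
    using assms by (intro oprod_cong) auto
  ultimately show ?thesis by (simp only: Env_def)
qed

lemma grid_index:
  assumes "I < grid_size d n" "m \<in> {1..d}"
  shows "lexidx n (modes d) I m < n m"
  using lexidx_less[of I n "modes d" m] assms by (simp add: prod_list_modes)

text \<open>Outside slot s the cores of the differentiated train are the original ones, so the
  partial products are the halves of the environment, and slot s contributes \<open>loc_op\<close>
  applied to the core derivative. The two rank indices merge into the core position.\<close>

lemma Jac_entry:
  assumes s: "s \<in> {1..d}" and p: "p < P s" and I: "I < grid_size d n"
  defines "i \<equiv> lexidx n (modes d) I"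
  shows "Jac dx dxi P n x G th s $$ (I, p) = (\<Sum>j=0..dxi. \<Sum>q=1..dx. \<Sum>a<core_size r s.
      Env dx dxi r x G th s j q i a * loc_op dx j q s (core_par_deriv s p (a div r s) (a mod r s)) (x s (i s)))"
proof -
  have sd: "1 \<le> s" "s \<le> d" using s by auto
  have z: "grid_point x i \<in> mode_box dx d"
    using grid grid_index[OF I] by (simp add: mode_box_def grid_point_def i_def)
  have "tt_fun r d (\<lambda>m \<alpha> \<beta>. loc_op dx j q m (deriv_cores s p m \<alpha> \<beta>)) (grid_point x i) =
      (\<Sum>a<core_size r s. Env dx dxi r x G th s j q i a *
        loc_op dx j q s (core_par_deriv s p (a div r s) (a mod r s)) (x s (i s)))" for j q
  proof -
    let ?K = "\<lambda>m. core_fun r (\<lambda>m \<alpha> \<beta>. loc_op dx j q m (deriv_cores s p m \<alpha> \<beta>)) m (grid_point x i m)"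
    have K: "?K m = op_core dx r G th j q m (x m (i m))" if "m \<noteq> s" for m
      using that by (simp add: core_fun_def op_core_def deriv_cores_def grid_point_def)
    have L: "oprod (r (s - 1)) ?K 1 s = op_left s j q i"
      unfolding op_left_def by (intro oprod_cong K) auto
    have R: "oprod 1 ?K (Suc s) (Suc d) = op_right s j q i"
      unfolding op_right_def by (intro oprod_cong K) auto
    have "tt_fun r d (\<lambda>m \<alpha> \<beta>. loc_op dx j q m (deriv_cores s p m \<alpha> \<beta>)) (grid_point x i) =
        (\<Sum>\<alpha><r (s - 1). \<Sum>\<beta><r s. op_left s j q i $$ (0, \<alpha>) *
          loc_op dx j q s (core_par_deriv s p \<alpha> \<beta>) (x s (i s)) * op_right s j q i $$ (\<beta>, 0))"
      unfolding tt_fun_slot[OF ranks sd] tt_slot_def L R by (simp add: deriv_cores_def grid_point_def)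
    also have "\<dots> = (\<Sum>a<core_size r s. op_left s j q i $$ (0, a div r s) *
          loc_op dx j q s (core_par_deriv s p (a div r s) (a mod r s)) (x s (i s)) * op_right s j q i $$ (a mod r s, 0))"
      unfolding core_size_def by (rule sum_divmod[symmetric])
    also have "\<dots> = (\<Sum>a<core_size r s. Env dx dxi r x G th s j q i a *
        loc_op dx j q s (core_par_deriv s p (a div r s) (a mod r s)) (x s (i s)))"
      by (intro sum.cong refl) (simp add: Env_eq[OF s])
    finally show ?thesis .
  qed
  moreover have "darcy dx dxi (\<lambda>z. par_deriv (P s) p (\<lambda>t. tt d G (th(s := t)) z) (th s)) (grid_point x i) =
      (\<Sum>j=0..dxi. \<Sum>q=1..dx. tt_fun r d (\<lambda>m \<alpha> \<beta>. loc_op dx j q m (deriv_cores s p m \<alpha> \<beta>)) (grid_point x i))"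
    using dims ranks z par_deriv_tt[OF s p] deriv_cores_smooth[OF s p] by (intro darcy_tt) auto
  ultimately show ?thesis
    using I p by (simp add: Jac_def i_def)
qed

lemma Psi_ch_carrier: "Psi_ch dx dxi r n x G th s l \<in> carrier_mat (grid_size d n) (n s * core_size r s)"
  by (simp add: Psi_ch_def)

lemma Sens_carrier: "Sens r P n x G th s l \<in> carrier_mat (n s * core_size r s) (P s)"
  by (simp add: Sens_def)

text \<open>The delta in the direction factor leaves the grid index \<open>i s\<close> alone; the
  sums are then reordered to match \<open>Jac_entry\<close>.\<close>

lemma Psi_Sens_entry:
  assumes s: "s \<in> {1..d}" and p: "p < P s" and I: "I < grid_size d n"
  defines "i \<equiv> lexidx n (modes d) I"
  shows "(Psi_ch dx dxi r n x G th s l * Sens r P n x G th s l) $$ (I, p) =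
    (\<Sum>j=0..dxi. \<Sum>q=1..dx. \<Sum>a<core_size r s. Env dx dxi r x G th s j q i a *
      (loc_coeff dx s l j q (x s (i s)) * (deriv ^^ l) (core_par_deriv s p (a div r s) (a mod r s)) (x s (i s))))"
proof -
  let ?k = "core_size r s"
  let ?f = "\<lambda>js a. (\<Sum>j=0..dxi. \<Sum>q=1..dx. loc_coeff dx s l j q (x s js) * Env dx dxi r x G th s j q i a) *
      (deriv ^^ l) (core_par_deriv s p (a div r s) (a mod r s)) (x s js)"
  have "(Psi_ch dx dxi r n x G th s l * Sens r P n x G th s l) $$ (I, p) =
      (\<Sum>c<n s * ?k. Psi_ch dx dxi r n x G th s l $$ (I, c) * Sens r P n x G th s l $$ (c, p))"
    using p I by (intro mult_mat_entry[OF Psi_ch_carrier Sens_carrier])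
  also have "\<dots> = (\<Sum>c<n s * ?k. of_bool (c div ?k = i s) * ?f (c div ?k) (c mod ?k))"
    using p I by (intro sum.cong refl)
      (simp add: Psi_ch_def Sens_def Let_def core_par_deriv_def[abs_def] i_def eq_commute[of "lexidx n (modes d) I s"])
  also have "\<dots> = (\<Sum>js<n s. \<Sum>a<?k. of_bool (js = i s) * ?f js a)"
    by (rule sum_divmod)
  also have "\<dots> = (\<Sum>a<?k. ?f (i s) a)"
    using grid_index[OF I s] by (simp flip: sum_distrib_left add: sum_lessThan_delta i_def)
  also have "\<dots> = (\<Sum>a<?k. \<Sum>j=0..dxi. \<Sum>q=1..dx. Env dx dxi r x G th s j q i a *
      (loc_coeff dx s l j q (x s (i s)) * (deriv ^^ l) (core_par_deriv s p (a div r s) (a mod r s)) (x s (i s))))"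
    unfolding sum_distrib_right by (intro sum.cong refl) (simp only: mult_ac)
  also have "\<dots> = (\<Sum>j=0..dxi. \<Sum>a<?k. \<Sum>q=1..dx. Env dx dxi r x G th s j q i a *
      (loc_coeff dx s l j q (x s (i s)) * (deriv ^^ l) (core_par_deriv s p (a div r s) (a mod r s)) (x s (i s))))"
    by (rule sum.swap)
  also have "\<dots> = (\<Sum>j=0..dxi. \<Sum>q=1..dx. \<Sum>a<?k. Env dx dxi r x G th s j q i a *
      (loc_coeff dx s l j q (x s (i s)) * (deriv ^^ l) (core_par_deriv s p (a div r s) (a mod r s)) (x s (i s))))"
    by (intro sum.cong refl sum.swap)
  finally show ?thesis .
qed

text \<open>\<open>loc_op\<close> is the sum over the channels of \<open>loc_coeff\<close> times a
  derivative, so the channel products add up to the Jacobian entry term by term.\<close>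

lemma Jac_factorization:
  assumes s: "s \<in> {1..d}"
  shows "Sens_full dx r P n x G th s \<in> carrier_mat (N_ch dx r n s) (P s)"
    and "Psi_full dx dxi r n x G th s \<in> carrier_mat (grid_size d n) (N_ch dx r n s)"
    and "Jac dx dxi P n x G th s = Psi_full dx dxi r n x G th s * Sens_full dx r P n x G th s"
proof -
  let ?\<Psi> = "Psi_ch dx dxi r n x G th s" and ?H = "Sens r P n x G th s"
  let ?k = "n s * core_size r s"
  have N: "N_ch dx r n s = (if s \<le> dx then ?k + (?k + ?k) else ?k)"
    by (simp add: N_ch_def)
  note carrier = Psi_ch_carrier[of s] Sens_carrier[of s]
  show S: "Sens_full dx r P n x G th s \<in> carrier_mat (N_ch dx r n s) (P s)"
    using carrier_append_rows[OF carrier(2)[of 0] carrier_append_rows[OF carrier(2)[of 1] carrier(2)[of 2]]] carrier(2)[of 0]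
    by (simp add: Sens_full_def N Let_def del: One_nat_def carrier_append_rows)
  show \<Psi>: "Psi_full dx dxi r n x G th s \<in> carrier_mat (grid_size d n) (N_ch dx r n s)"
    using append_columns_carrier[OF carrier(1)[of 0] append_columns_carrier[OF carrier(1)[of 1] carrier(1)[of 2]]] carrier(1)[of 0]
    by (simp add: Psi_full_def N Let_def del: One_nat_def)
  show "Jac dx dxi P n x G th s = Psi_full dx dxi r n x G th s * Sens_full dx r P n x G th s"
  proof (rule eq_matI)
    fix I p
    assume "I < dim_row (Psi_full dx dxi r n x G th s * Sens_full dx r P n x G th s)"
      "p < dim_col (Psi_full dx dxi r n x G th s * Sens_full dx r P n x G th s)"
    then have I: "I < grid_size d n" and p: "p < P s"
      using S \<Psi> by auto
    have prod: "Psi_full dx dxi r n x G th s * Sens_full dx r P n x G th s =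
        (if s \<le> dx then ?\<Psi> 0 * ?H 0 + (?\<Psi> 1 * ?H 1 + ?\<Psi> 2 * ?H 2) else ?\<Psi> 0 * ?H 0)"
      unfolding Psi_full_def Sens_full_def Let_def
      using append_columns_mult[OF carrier(1)[of 0] append_columns_carrier[OF carrier(1)[of 1] carrier(1)[of 2]]
          carrier(2)[of 0] carrier_append_rows[OF carrier(2)[of 1] carrier(2)[of 2]]]
        append_columns_mult[OF carrier(1)[of 1] carrier(1)[of 2] carrier(2)[of 1] carrier(2)[of 2]]
      by simp
    show "Jac dx dxi P n x G th s $$ (I, p) = (Psi_full dx dxi r n x G th s * Sens_full dx r P n x G th s) $$ (I, p)"
    proof (cases "s \<le> dx")
      case True
      have "dim_row (?\<Psi> l * ?H l) = grid_size d n" "dim_col (?\<Psi> l * ?H l) = P s" for l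
        using carrier[of l] by auto
      then have "(Psi_full dx dxi r n x G th s * Sens_full dx r P n x G th s) $$ (I, p) =
          (?\<Psi> 0 * ?H 0) $$ (I, p) + ((?\<Psi> 1 * ?H 1) $$ (I, p) + (?\<Psi> 2 * ?H 2) $$ (I, p))"
        unfolding prod using I p True by (simp del: index_mult_mat(1))
      then show ?thesis
        unfolding Jac_entry[OF s p I] Psi_Sens_entry[OF s p I] sum.distrib[symmetric]
        using True by (auto intro!: sum.cong simp: loc_op_def loc_coeff_def algebra_simps)
    next
      case False
      then have "(Psi_full dx dxi r n x G th s * Sens_full dx r P n x G th s) $$ (I, p) = (?\<Psi> 0 * ?H 0) $$ (I, p)"
        unfolding prod by simp
      then show ?thesis
        \<comment> \<open>Here q \<le> dx < s, so \<open>loc_op\<close> is pure multiplication and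
          channel 0 is complete.\<close>
        unfolding Jac_entry[OF s p I] Psi_Sens_entry[OF s p I]
        using False by (auto intro!: sum.cong simp: loc_op_def loc_coeff_def)
    qed
  qed (use S \<Psi> in \<open>auto simp: Jac_def\<close>)
qed

section \<open>Environments in block form\<close>

definition A_at :: "nat \<Rightarrow> (nat \<Rightarrow> nat) \<Rightarrow> nat \<Rightarrow> real mat" where
  "A_at j i m = A_core dx G th j m (x m (i m))"

definition B_at :: "nat \<Rightarrow> (nat \<Rightarrow> nat) \<Rightarrow> nat \<Rightarrow> real mat" where
  "B_at j i m = B_core dx r G th j m (x m (i m))"

lemma chain_AB:
  assumes "\<And>m. m \<in> {1..d} \<Longrightarrow> i m < n m" "1 \<le> a" "b \<le> Suc d"
  shows "chain r (A_at j i) a b" "chain r (B_at j i) a b"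
  using core_carrier params grid assms by (auto simp: chain_def A_at_def B_at_def A_core_def B_core_def)

text \<open>The product rule reconciles the expanded form in \<open>loc_op\<close> with the
  divergence form in \<open>B_core\<close>. It turns the pair (j,q) into a function update at q, the
  shape in which the block recursions produce their summands.\<close>

lemma op_core_eq:
  assumes i: "\<And>m. m \<in> {1..d} \<Longrightarrow> i m < n m" and q: "q \<in> {1..dx}" and m: "m \<in> {1..d}"
  shows "op_core dx r G th j q m (x m (i m)) = ((A_at j i)(q := B_at j i q)) m"
proof (cases "m = q")
  case True
  have y: "x m (i m) \<in> dom1 dx m" using grid i m by simp
  have "loc_op dx j q m (\<lambda>w. G m (th m) w $$ (\<alpha>, \<beta>)) (x m (i m)) =
      - deriv (\<lambda>w. kap dx j m w * deriv (\<lambda>w'. G m (th m) w' $$ (\<alpha>, \<beta>)) w) (x m (i m))"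
    if "\<alpha> < r (m - 1)" "\<beta> < r m" for \<alpha> \<beta>
  proof -
    let ?g = "\<lambda>w. G m (th m) w $$ (\<alpha>, \<beta>)"
    have mx: "m \<in> {1..dx}" using q True by simp
    have "(kap dx j m has_real_derivative deriv (kap dx j m) (x m (i m))) (at (x m (i m)))"
      using kap_differentiable mx by (simp add: DERIV_deriv_iff_field_differentiable)
    moreover have "(deriv ?g has_real_derivative deriv (deriv ?g) (x m (i m))) (at (x m (i m)))"
      using core_smooth(2)[OF mx that y] by (simp add: DERIV_deriv_iff_field_differentiable)
    ultimately have "((\<lambda>w. kap dx j m w * deriv ?g w) has_real_derivative
        deriv (kap dx j m) (x m (i m)) * deriv ?g (x m (i m)) + deriv (deriv ?g) (x m (i m)) * kap dx j m (x m (i m)))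
        (at (x m (i m)))"
      by (rule DERIV_mult)
    from DERIV_imp_deriv[OF this] show ?thesis
      using True by (simp add: loc_op_def numeral_2_eq_2)
  qed
  then show ?thesis
    using True q by (intro eq_matI) (auto simp: op_core_def B_at_def B_core_def)
next
  case False
  then show ?thesis
    using core_carrier[OF m params[OF m], of "x m (i m)"] grid i m
    by (intro eq_matI) (auto simp: op_core_def A_at_def A_core_def loc_op_def)
qed

definition env_left :: "nat \<Rightarrow> nat \<Rightarrow> nat \<Rightarrow> (nat \<Rightarrow> nat) \<Rightarrow> real mat" where
  "env_left s j q i = oprod (r (s - 1)) ((A_at j i)(q := B_at j i q)) 1 s"

definition env_right :: "nat \<Rightarrow> nat \<Rightarrow> nat \<Rightarrow> (nat \<Rightarrow> nat) \<Rightarrow> real mat" where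
  "env_right s j q i = oprod 1 ((A_at j i)(q := B_at j i q)) (Suc s) (Suc d)"

lemma Env_block:
  assumes i: "\<And>m. m \<in> {1..d} \<Longrightarrow> i m < n m" and s: "s \<in> {1..d}" and a: "a < core_size r s" and q: "q \<in> {1..dx}"
  shows "Env dx dxi r x G th s j q i a = env_left s j q i $$ (0, a div r s) * env_right s j q i $$ (a mod r s, 0)"
proof -
  have "op_left s j q i = env_left s j q i" "op_right s j q i = env_right s j q i"
    unfolding op_left_def env_left_def op_right_def env_right_def
    using s by (auto intro!: oprod_cong op_core_eq[OF i q])
  then show ?thesis by (simp only: Env_eq[OF s a])
qed

text \<open>Reconciles the two ranges of q: the operator sums over spatial modes, whereas the block
  products sum over all modes other than s. As q differs from s, the zero core lies in one of the
  two partial products.\<close>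

lemma env_zero:
  assumes i: "\<And>m. m \<in> {1..d} \<Longrightarrow> i m < n m" and s: "s \<in> {1..d}" and q: "q \<in> {1..d} - {s}" "dx < q"
    and \<alpha>\<beta>: "\<alpha> < r (s - 1)" "\<beta> < r s"
  shows "env_left s j q i $$ (0, \<alpha>) * env_right s j q i $$ (\<beta>, 0) = 0"
proof -
  let ?F = "(A_at j i)(q := B_at j i q)"
  have ch: "chain r ?F 1 s" "chain r ?F (Suc s) (Suc d)"
    using s by (auto intro!: chain_fun_upd chain_AB i)
  have Fq: "?F q = 0\<^sub>m (r (q - 1)) (r q)"
    using q by (simp add: B_at_def B_core_def)
  consider "q < s" | "s < q" using q by fastforce
  then show ?thesis
  proof cases
    case 1
    then have "env_left s j q i = 0\<^sub>m (r (1 - 1)) (r (s - 1))"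
      unfolding env_left_def using q by (intro oprod_zero[OF _ _ _ ch(1) refl Fq]) auto
    then show ?thesis using \<alpha>\<beta> ranks by simp
  next
    case 2
    then have "env_right s j q i = 0\<^sub>m (r (Suc s - 1)) (r (Suc d - 1))"
      unfolding env_right_def using q ranks by (intro oprod_zero[OF _ _ _ ch(2) _ Fq]) auto
    then show ?thesis using \<alpha>\<beta> ranks by simp
  qed
qed

lemma Q_left_eq:
  "Q_left dx r G th j s (grid_point x i) =
    mat_of_rows_list 2 [[1, 0]] * oprod (2 * r (s - 1)) (blk r (A_at j i) (B_at j i)) 1 s"
  by (simp add: Q_left_def blk_def[abs_def] block_core_def A_at_def[abs_def] B_at_def[abs_def] grid_point_def)

lemma Q_right_eq:
  "Q_right dx dxi r G th j s (grid_point x i) =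
    oprod (2 * r d) (blk r (A_at j i) (B_at j i)) (Suc s) (Suc d) * mat_of_rows_list 1 [[0], [1]]"
  by (simp add: Q_right_def blk_def[abs_def] block_core_def A_at_def[abs_def] B_at_def[abs_def] grid_point_def)

lemma Q_carrier:
  assumes i: "\<And>m. m \<in> {1..d} \<Longrightarrow> i m < n m" and s: "s \<in> {1..d}"
  shows "Q_left dx r G th j s (grid_point x i) \<in> carrier_mat 1 (2 * r (s - 1))"
    and "Q_right dx dxi r G th j s (grid_point x i) \<in> carrier_mat (2 * r s) 1"
proof -
  show "Q_left dx r G th j s (grid_point x i) \<in> carrier_mat 1 (2 * r (s - 1))"
    unfolding Q_left_eq using s ranks by (intro left_carrier chain_AB i) auto
  have "oprod (2 * r d) (blk r (A_at j i) (B_at j i)) (Suc s) (Suc d) * mat_of_rows_list 1 [[0], [1]]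
      \<in> carrier_mat (2 * r (Suc s - 1)) 1"
    using s ranks by (intro right_carrier chain_AB i) auto
  then show "Q_right dx dxi r G th j s (grid_point x i) \<in> carrier_mat (2 * r s) 1"
    unfolding Q_right_eq by simp
qed

text \<open>For channel 0 the summands q < s share the unmodified right product and those with q > s
  the unmodified left product, giving derivative times value plus value times derivative. For
  channels 1 and 2 only q = s remains, giving value times value.\<close>

lemma Psi_ch_block_summand:
  assumes i: "\<And>m. m \<in> {1..d} \<Longrightarrow> i m < n m" and s: "s \<in> {1..d}" and l: "l \<in> channels dx s"
    and a: "a < core_size r s"
  shows "(\<Sum>q=1..dx. loc_coeff dx s l j q y * Env dx dxi r x G th s j q i a) =
    (Q_left dx r G th j s (grid_point x i) * P_mat dx r s l a j y * Q_right dx dxi r G th j s (grid_point x i)) $$ (0, 0)"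
proof -
  let ?a = "a div r s" and ?b = "a mod r s"
  let ?X = "Q_left dx r G th j s (grid_point x i)" and ?Y = "Q_right dx dxi r G th j s (grid_point x i)"
  let ?L = "\<lambda>q. env_left s j q i $$ (0, ?a)" and ?R = "\<lambda>q. env_right s j q i $$ (?b, 0)"
  note ab = core_index[OF a]
  \<comment> \<open>An update at or beyond s does not reach the left product, so \<open>?L s\<close>
    serves as a name for the plain product; likewise \<open>?R s\<close> on the right.\<close>
  have L0: "oprod (r (s - 1)) (A_at j i) 1 s $$ (0, ?a) = ?L q" if "s \<le> q" for q
    unfolding env_left_def using that by (intro arg_cong[where f = "\<lambda>M. M $$ _"] oprod_cong) auto
  have R0: "oprod 1 (A_at j i) (Suc s) (Suc d) $$ (?b, 0) = ?R q" if "q \<le> s" for q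
    unfolding env_right_def using that by (intro arg_cong[where f = "\<lambda>M. M $$ _"] oprod_cong) auto
  have XL: "\<forall>\<beta><r (s - 1).
      ?X $$ (0, \<beta>) = oprod (r (s - 1)) (A_at j i) 1 s $$ (0, \<beta>) \<and>
      ?X $$ (0, r (s - 1) + \<beta>) = (\<Sum>q=1..<s. env_left s j q i $$ (0, \<beta>))"
    unfolding Q_left_eq env_left_def using s ranks by (intro left_entries chain_AB i) auto
  have "\<forall>\<beta><r (Suc s - 1).
      ?Y $$ (r (Suc s - 1) + \<beta>, 0) = oprod 1 (A_at j i) (Suc s) (Suc d) $$ (\<beta>, 0) \<and>
      ?Y $$ (\<beta>, 0) = (\<Sum>q=Suc s..<Suc d. env_right s j q i $$ (\<beta>, 0))"
    unfolding Q_right_eq env_right_def using s ranks by (intro right_entries chain_AB i) auto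
  then have Y: "?Y $$ (r s + ?b, 0) = ?R s" "?Y $$ (?b, 0) = (\<Sum>q=Suc s..<Suc d. ?R q)"
    using ab R0[of s] unfolding diff_Suc_1 by auto
  have X: "?X $$ (0, ?a) = ?L s" "?X $$ (0, r (s - 1) + ?a) = (\<Sum>q=1..<s. ?L q)"
    using XL ab L0[of s] by auto
  have E: "Env dx dxi r x G th s j q i a = ?L q * ?R q" if "q \<in> {1..dx}" for q
    by (rule Env_block[OF i s a that])
  have "?X \<in> carrier_mat 1 (2 * r (s - 1))" "?Y \<in> carrier_mat (2 * r s) 1"
    by (rule Q_carrier, fact i, fact s)+
  note P = mult_P_mat[OF this a]
  show ?thesis
  proof (cases "l = 0")
    case True
    have coeff: "loc_coeff dx s 0 j q y = (if q = s then 0 else kap dx j s y)" if "q \<in> {1..dx}" for q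
      using that by (auto simp: loc_coeff_def)
    have set: "{1..d} - {s} = {1..<s} \<union> {Suc s..<Suc d}"
      using s by auto
    have "(\<Sum>q=1..dx. loc_coeff dx s 0 j q y * Env dx dxi r x G th s j q i a) =
        (\<Sum>q\<in>{1..dx} - {s}. kap dx j s y * (?L q * ?R q))"
      by (intro sum.mono_neutral_cong_right) (auto simp: coeff E)
    \<comment> \<open>Parameter modes are added at no cost by \<open>env_zero\<close>, so that the
      range is the one produced by the block products.\<close>
    also have "\<dots> = (\<Sum>q\<in>{1..d} - {s}. kap dx j s y * (?L q * ?R q))"
    proof (intro sum.mono_neutral_left ballI)
      fix q assume "q \<in> {1..d} - {s} - ({1..dx} - {s})"
      then show "kap dx j s y * (?L q * ?R q) = 0"
        using env_zero[OF i s _ _ ab, of q j] by auto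
    qed auto
    also have "\<dots> = kap dx j s y * ((\<Sum>q=1..<s. ?L q * ?R q) + (\<Sum>q=Suc s..<Suc d. ?L q * ?R q))"
      unfolding set sum_distrib_left[symmetric] by (subst sum.union_disjoint) auto
    also have "(\<Sum>q=1..<s. ?L q * ?R q) = (\<Sum>q=1..<s. ?L q) * ?R s"
      unfolding sum_distrib_right using R0[symmetric] by (intro sum.cong refl) simp
    also have "(\<Sum>q=Suc s..<Suc d. ?L q * ?R q) = ?L s * (\<Sum>q=Suc s..<Suc d. ?R q)"
      unfolding sum_distrib_left using L0[symmetric] by (intro sum.cong refl) simp
    finally show ?thesis
      unfolding True P X Y by (simp only: add.commute)
  next
    case False
    then have sx: "s \<in> {1..dx}" and l: "l = 1 \<or> l = 2"
      using l s by (auto simp: channels_def split: if_splits)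
    have "(\<Sum>q=1..dx. loc_coeff dx s l j q y * Env dx dxi r x G th s j q i a) =
        (\<Sum>q\<in>{s}. loc_coeff dx s l j q y * Env dx dxi r x G th s j q i a)"
      using sx False by (intro sum.mono_neutral_right) (auto simp: loc_coeff_def)
    then show ?thesis
      using l
    proof (elim disjE, goal_cases)
      case 1
      then show ?case unfolding 1(2) P X Y using sx by (simp add: loc_coeff_def E)
    next
      case 2
      then show ?case unfolding 2(2) P X Y using sx by (simp add: loc_coeff_def E)
    qed
  qed
qed

lemma Psi_ch_block:
  assumes i: "\<And>m. m \<in> {1..d} \<Longrightarrow> i m < n m" and s: "s \<in> {1..d}" and l: "l \<in> channels dx s"
    and js: "js < n s" and a: "a < core_size r s"
  shows "Psi_ch dx dxi r n x G th s l $$ (lexpos n (modes d) i, js * core_size r s + a) =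
    of_bool (i s = js) * (\<Sum>j=0..dxi.
      (Q_left dx r G th j s (grid_point x i) * P_mat dx r s l a j (x s js) * Q_right dx dxi r G th j s (grid_point x i)) $$ (0, 0))"
proof -
  have idx: "lexidx n (modes d) (lexpos n (modes d) i) m = i m" if "m \<in> {1..d}" for m
    using lexidx_lexpos[of "modes d" i n m] i that by simp
  have row: "lexpos n (modes d) i < grid_size d n"
    using lexpos_less[of "modes d" i n] i by (simp add: prod_list_modes)
  \<comment> \<open>The column position must lie inside the matrix before it can be decoded by
    quotient and remainder.\<close>
  have "js * core_size r s + a < Suc js * core_size r s" using a by simp
  also have "\<dots> \<le> n s * core_size r s" using js by (intro mult_le_mono1) simp
  finally have col: "js * core_size r s + a < n s * core_size r s" .
  have "Env dx dxi r x G th s j q (lexidx n (modes d) (lexpos n (modes d) i)) a = Env dx dxi r x G th s j q i a" for j q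
    using idx s by (rule Env_cong)
  moreover have "(\<Sum>j=0..dxi. \<Sum>q=1..dx. loc_coeff dx s l j q (x s js) * Env dx dxi r x G th s j q i a) =
    (\<Sum>j=0..dxi. (Q_left dx r G th j s (grid_point x i) * P_mat dx r s l a j (x s js)
      * Q_right dx dxi r G th j s (grid_point x i)) $$ (0, 0))"
    by (intro sum.cong refl Psi_ch_block_summand i s l a)
  ultimately show ?thesis
    using row col a idx[OF s] by (simp add: Psi_ch_def Let_def del: One_nat_def)
qed

end

section \<open>Compressed dimension and assembly of the results\<close>

lemma N_eff_eq:
  "N_eff dx dxi r n =
    3 * (\<Sum>s=1..dx. n s * r (s - 1) * r s) + (\<Sum>s=dx + 1..dx + dxi. n s * r (s - 1) * r s)"
proof -
  have "{1..dx + dxi} = {1..dx} \<union> {dx + 1..dx + dxi}" by auto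
  then have "N_eff dx dxi r n = (\<Sum>s=1..dx. N_ch dx r n s) + (\<Sum>s=dx + 1..dx + dxi. N_ch dx r n s)"
    unfolding N_eff_def by (simp add: sum.union_disjoint)
  also have "(\<Sum>s=1..dx. N_ch dx r n s) = 3 * (\<Sum>s=1..dx. n s * r (s - 1) * r s)"
    unfolding sum_distrib_left by (intro sum.cong) (auto simp: N_ch_def core_size_def)
  also have "(\<Sum>s=dx + 1..dx + dxi. N_ch dx r n s) = (\<Sum>s=dx + 1..dx + dxi. n s * r (s - 1) * r s)"
    by (intro sum.cong) (auto simp: N_ch_def core_size_def)
  finally show ?thesis .
qed

theorem proposition5p5:
  fixes dx dxi :: nat
    and r P n :: "nat \<Rightarrow> nat"
    and x :: "nat \<Rightarrow> nat \<Rightarrow> real"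
    and G :: "nat \<Rightarrow> real vec \<Rightarrow> real \<Rightarrow> real mat"
    and th :: "nat \<Rightarrow> real vec"
  assumes dims: "1 \<le> dx" "1 \<le> dxi"
    and ranks: "r 0 = 1" "r (dx + dxi) = 1"
    and grid: "\<And>m i. m \<in> {1..dx + dxi} \<Longrightarrow> i < n m \<Longrightarrow> x m i \<in> dom1 dx m"
    and params: "\<And>m. m \<in> {1..dx + dxi} \<Longrightarrow> th m \<in> carrier_vec (P m)"
    and core_dims: "\<And>m t y. m \<in> {1..dx + dxi} \<Longrightarrow> t \<in> carrier_vec (P m) \<Longrightarrow>
          y \<in> closure (dom1 dx m) \<Longrightarrow> G m t y \<in> carrier_mat (r (m - 1)) (r m)"
    and smooth: "\<And>m \<alpha> \<beta>. m \<in> {1..dx + dxi} \<Longrightarrow> \<alpha> < r (m - 1) \<Longrightarrow> \<beta> < r m \<Longrightarrow>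
          Ck_differentiable (if m \<le> dx then 2 else 0) (closure (dom1 dx m)) (P m)
            (\<lambda>t y. G m t y $$ (\<alpha>, \<beta>))"
  shows
    "(\<forall>s\<in>{1..dx + dxi}.
       Sens_full dx r P n x G th s \<in> carrier_mat (N_ch dx r n s) (P s) \<and>
       Psi_full dx dxi r n x G th s \<in> carrier_mat (grid_size (dx + dxi) n) (N_ch dx r n s) \<and>
       Jac dx dxi P n x G th s = Psi_full dx dxi r n x G th s * Sens_full dx r P n x G th s) \<and>
     (\<forall>s\<in>{1..dx + dxi}. \<forall>l\<in>channels dx s.
       Psi_ch dx dxi r n x G th s l \<in> carrier_mat (grid_size (dx + dxi) n) (n s * core_size r s) \<and>
       (\<forall>i js a. (\<forall>m\<in>{1..dx + dxi}. i m < n m) \<longrightarrow> js < n s \<longrightarrow> a < core_size r s \<longrightarrow>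
          (\<forall>j\<le>dxi.
             Q_left dx r G th j s (grid_point x i) \<in> carrier_mat 1 (2 * r (s - 1)) \<and>
             P_mat dx r s l a j (x s js) \<in> carrier_mat (2 * r (s - 1)) (2 * r s) \<and>
             Q_right dx dxi r G th j s (grid_point x i) \<in> carrier_mat (2 * r s) 1) \<and>
          Psi_ch dx dxi r n x G th s l $$ (lexpos n (modes (dx + dxi)) i, js * core_size r s + a) =
            of_bool (i s = js) *
            (\<Sum>j=0..dxi. (Q_left dx r G th j s (grid_point x i) * P_mat dx r s l a j (x s js)
                         * Q_right dx dxi r G th j s (grid_point x i)) $$ (0, 0)))) \<and>
     N_eff dx dxi r n =
       3 * (\<Sum>s=1..dx. n s * r (s - 1) * r s) + (\<Sum>s=dx + 1..dx + dxi. n s * r (s - 1) * r s)"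
proof -
  interpret darcy_tt_data dx dxi r P n x G th
    by unfold_locales (fact dims ranks grid params core_dims smooth)+
  show ?thesis
  proof (intro conjI ballI allI impI)
    fix s assume s: "s \<in> {1..dx + dxi}"
    show "Sens_full dx r P n x G th s \<in> carrier_mat (N_ch dx r n s) (P s)"
      "Psi_full dx dxi r n x G th s \<in> carrier_mat (grid_size (dx + dxi) n) (N_ch dx r n s)"
      "Jac dx dxi P n x G th s = Psi_full dx dxi r n x G th s * Sens_full dx r P n x G th s"
      by (rule Jac_factorization[OF s])+
    fix l assume l: "l \<in> channels dx s"
    show "Psi_ch dx dxi r n x G th s l \<in> carrier_mat (grid_size (dx + dxi) n) (n s * core_size r s)"
      by (rule Psi_ch_carrier)
    fix i :: "nat \<Rightarrow> nat" and js a
    assume "\<forall>m\<in>{1..dx + dxi}. i m < n m" and js: "js < n s" and a: "a < core_size r s"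
    then have i: "i m < n m" if "m \<in> {1..dx + dxi}" for m
      using that by blast
    show "Psi_ch dx dxi r n x G th s l $$ (lexpos n (modes (dx + dxi)) i, js * core_size r s + a) =
        of_bool (i s = js) *
        (\<Sum>j=0..dxi. (Q_left dx r G th j s (grid_point x i) * P_mat dx r s l a j (x s js)
                     * Q_right dx dxi r G th j s (grid_point x i)) $$ (0, 0))"
      by (rule Psi_ch_block[OF _ s l js a]) (rule i)
    show "Q_left dx r G th j s (grid_point x i) \<in> carrier_mat 1 (2 * r (s - 1))"
      "Q_right dx dxi r G th j s (grid_point x i) \<in> carrier_mat (2 * r s) 1" for j
      by (rule Q_carrier, erule i, rule s)+
    show "P_mat dx r s l a j (x s js) \<in> carrier_mat (2 * r (s - 1)) (2 * r s)" for j
      by (rule P_mat_carrier)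
  qed (rule N_eff_eq)
qed

end
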